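(* Let $n \geq 5$. Then $\tilde{H}_i(\mathcal{VR}(\mathbb{I}_n;3);\mathbb{Z}) \neq 0$ if and only if $i \in \{4,7\}$.
   Context: For $n\ge 1$, $\mathbb{I}_n$ is the $n$-dimensional hypercube graph: its vertex set is $\{0,1\}^n$ and two vertices are adjacent iff they differ in exactly one coordinate. It is regarded as a metric space with the shortest-path distance, which equals the Hamming distance $d(v,w)=\#\{i : v(i)\neq w(i)\}$, where $v(i)$ denotes the $i$-th coordinate of $v$. For a metric space $(X,d)$ and $r\ge 0$, the Vietoris–Rips complex $\mathcal{VR}(X;r)$ is the simplicial complex on vertex set $X$ whose simplices are the finite subsets $\sigma\subseteq X$ with $d(x,y)\le r$ for all $x,y\in\sigma$. $\tilde H_i$ denotes reduced simplicial homology. *)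

theory Defs
  imports "HOL-Algebra.Algebra" "HOL-Library.List_Lexorder"
begin

text \<open>Vietoris-Rips complex of a metric space (V,dist) at scale r. We include the
  empty simplex; it plays the role of the (-1)-dimensional simplex of the
  augmented chain complex, whose homology is reduced homology.\<close>
definition vr_complex :: "'a set \<Rightarrow> ('a \<Rightarrow> 'a \<Rightarrow> real) \<Rightarrow> real \<Rightarrow> 'a set set" where
  "vr_complex V dst rad = {S. S \<subseteq> V \<and> finite S \<and> (\<forall>x\<in>S. \<forall>y\<in>S. dst x y \<le> rad)}"

definition simplices_of_dim :: "'a set set \<Rightarrow> int \<Rightarrow> 'a set set" where
  "simplices_of_dim K i = {S\<in>K. int (card S) = i + 1}"

text \<open>Augmented simplicial chain group C_i(K;Z): integer-valued functions supported on
  the i-simplices (K finite), with pointwise addition.\<close>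
definition chain_group :: "'a set set \<Rightarrow> int \<Rightarrow> ('a set \<Rightarrow> int) monoid" where
  "chain_group K i = \<lparr>carrier = {c. \<forall>S. c S \<noteq> 0 \<longrightarrow> S \<in> simplices_of_dim K i},
                      monoid.mult = (\<lambda>c c' S. c S + c' S), monoid.one = (\<lambda>S. 0)\<rparr>"

text \<open>Simplicial boundary, orienting simplices by the linear order on vertices:
  the coefficient of tau in the boundary of insert v tau (v not in tau) is
  (-1)^(position of v in the sorted vertex list).\<close>
definition boundary :: "'a::linorder set set \<Rightarrow> ('a set \<Rightarrow> int) \<Rightarrow> ('a set \<Rightarrow> int)" where
  "boundary K c = (\<lambda>T. if T \<in> K then
      (\<Sum>v\<in>{v. v \<notin> T \<and> insert v T \<in> K}. (-1) ^ card {w\<in>T. w < v} * c (insert v T))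
    else 0)"

definition cycles :: "'a::linorder set set \<Rightarrow> int \<Rightarrow> ('a set \<Rightarrow> int) set" where
  "cycles K i = {c \<in> carrier (chain_group K i). boundary K c = (\<lambda>S. 0)}"

definition boundaries :: "'a::linorder set set \<Rightarrow> int \<Rightarrow> ('a set \<Rightarrow> int) set" where
  "boundaries K i = boundary K ` carrier (chain_group K (i + 1))"

definition reduced_homology :: "'a::linorder set set \<Rightarrow> int \<Rightarrow> ('a set \<Rightarrow> int) set monoid" where
  "reduced_homology K i = ((chain_group K i)\<lparr>carrier := cycles K i\<rparr>) Mod (boundaries K i)"

text \<open>Hypercube graph I_n: vertices {0,1}^n as boolean lists of length n,
  with Hamming distance (= shortest path distance).\<close>
definition hypercube :: "nat \<Rightarrow> bool list set" where
  "hypercube n = {v. length v = n}"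

definition hamming :: "bool list \<Rightarrow> bool list \<Rightarrow> real" where
  "hamming v w = real (card {i. i < length v \<and> v ! i \<noteq> w ! i})"

end

(* A discrete Morse matching on VR(I_n;3), empty simplex included, whose critical simplices have
   5 or 8 vertices; both sizes occur when n >= 5. As these sizes differ by more than one, the
   homology lives exactly in degrees 4 and 7.

   The matching. For a simplex S let p be the first coordinate at which some vertex of S is False,
   T the set of vertices of S that are False at p, and C the set of all vertices y that are True at
   the coordinates up to p and within distance 3 of T; the rest of S lies in C. If C is nonempty, a
   parity argument gives a vertex of C within distance 3 of all of C; toggling it in S changes
   neither p nor T. If C is empty, then S = T lies in no ball of radius 2. Such a set is a full
   3-cube or spans a 4-cube: let S contain antipodal vertices a, b of a 3-cube. Every vertex of S
   leaves that 3-cube in at most one direction; if two directions occurred, the projections to the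
   3-cube of the vertices off it would lie on the hexagon obtained by deleting a and b, and one of
   them would be the center of a ball of radius 2 around S. In a fixed 4-cube the sets without
   antipodal pairs that lie in no ball of radius 2 are matched by an explicit decision tree. *)

theory Submission imports Defs begin

section \<open>Homology from an acyclic matching\<close>

definition flip :: "'a \<Rightarrow> 'a set \<Rightarrow> 'a set" where
  "flip v S = (if v \<in> S then S - {v} else insert v S)"

section \<open>Chains, boundaries and homology of a finite complex\<close>

lemma mem_chain_group_iff:
  "c \<in> carrier (chain_group K i) \<longleftrightarrow> (\<forall>S. c S \<noteq> 0 \<longrightarrow> S \<in> K \<and> int (card S) = i + 1)"
  by (simp add: chain_group_def simplices_of_dim_def)

text \<open>The one form \<open>a S - s * b S\<close> serves for differences (\<open>s = 1\<close>)
  and sums (\<open>s = -1\<close>) alike.\<close>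

lemma chain_group_diff:
  assumes "a \<in> carrier (chain_group K i)" "b \<in> carrier (chain_group K i)"
  shows "(\<lambda>S. a S - s * b S) \<in> carrier (chain_group K i)"
  using assms unfolding mem_chain_group_iff by (metis diff_zero mult_zero_right)

lemma boundary_diff:
  "boundary K (\<lambda>S. a S - s * b S) = (\<lambda>T. boundary K a T - s * boundary K b T)"
  by (rule ext) (simp add: boundary_def sum_subtractf sum_distrib_left right_diff_distrib mult.left_commute)

lemma boundary_zero: "boundary K (\<lambda>S. 0) = (\<lambda>S. 0)"
  by (rule ext) (simp add: boundary_def)

text \<open>Inserting the smaller vertex shifts the position of the larger one by one, while
  inserting the larger one leaves the position of the smaller one unchanged. So the two orders of
  insertion give opposite signs.\<close>

lemma boundary_sgn_swap:
  fixes v w :: "'a::linorder"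
  assumes "finite T" "v \<notin> T" "w \<notin> T" "v \<noteq> w"
  shows "(-1::int) ^ card {x\<in>T. x < v} * (-1) ^ card {x\<in>insert v T. x < w}
       = - ((-1) ^ card {x\<in>T. x < w} * (-1) ^ card {x\<in>insert w T. x < v})"
proof -
  have step: "(-1::int) ^ card {x\<in>insert a T. x < b} = (if a < b then -1 else 1) * (-1) ^ card {x\<in>T. x < b}"
    if "a \<notin> T" for a b
  proof (cases "a < b")
    case True
    then have "{x\<in>insert a T. x < b} = insert a {x\<in>T. x < b}" by auto
    then show ?thesis using that assms(1) True by simp
  next
    case False
    then have "{x\<in>insert a T. x < b} = {x\<in>T. x < b}" by auto
    then show ?thesis using False by simp
  qed
  have "v < w \<longleftrightarrow> \<not> w < v" using assms(4) by auto
  then show ?thesis unfolding step[OF assms(2)] step[OF assms(3)] by (simp only: split: if_split) simp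
qed

locale finite_complex =
  fixes K :: "'a::linorder set set"
  assumes finite_K: "finite K"
    and finite_simplex: "S \<in> K \<Longrightarrow> finite S"
    and down_closed: "S \<in> K \<Longrightarrow> T \<subseteq> S \<Longrightarrow> T \<in> K"
begin

lemma finite_cofaces: "finite {v. v \<notin> T \<and> insert v T \<in> K}"
proof (rule finite_subset)
  show "{v. v \<notin> T \<and> insert v T \<in> K} \<subseteq> \<Union>K" by auto
  show "finite (\<Union>K)" using finite_K finite_simplex by blast
qed

lemma boundary_in_chain_group:
  assumes c: "c \<in> carrier (chain_group K i)"
  shows "boundary K c \<in> carrier (chain_group K (i - 1))"
  unfolding mem_chain_group_iff
proof (intro allI impI)
  fix T assume nz: "boundary K c T \<noteq> 0"
  then have T: "T \<in> K" by (simp add: boundary_def split: if_splits)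
  have "\<exists>v. v \<notin> T \<and> c (insert v T) \<noteq> 0"
  proof (rule ccontr)
    assume "\<not> (\<exists>v. v \<notin> T \<and> c (insert v T) \<noteq> 0)"
    then have "boundary K c T = 0" by (auto simp: boundary_def intro!: sum.neutral)
    then show False using nz by simp
  qed
  then obtain v where "v \<notin> T" "c (insert v T) \<noteq> 0" by blast
  then have "int (card (insert v T)) = i + 1" "v \<notin> T" using c mem_chain_group_iff by blast+
  then show "T \<in> K \<and> int (card T) = i - 1 + 1" using T finite_simplex[OF T] by simp
qed

text \<open>Two extra vertices can be inserted in either order, with opposite signs; exchanging the
  orders shows that the sum equals its own negative.\<close>

lemma boundary_boundary: "boundary K (boundary K c) = (\<lambda>S. 0)"
proof
  fix T
  show "boundary K (boundary K c) T = 0"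
  proof (cases "T \<in> K")
    case False then show ?thesis by (simp add: boundary_def)
  next
    case T: True
    define P where "P = Sigma {v. v \<notin> T \<and> insert v T \<in> K}
      (\<lambda>v. {w. w \<notin> insert v T \<and> insert w (insert v T) \<in> K})"
    define f where "f = (\<lambda>(v, w). (-1::int) ^ card {x\<in>T. x < v} * (-1) ^ card {x\<in>insert v T. x < w}
       * c (insert w (insert v T)))"
    have "boundary K (boundary K c) T = (\<Sum>v\<in>{v. v \<notin> T \<and> insert v T \<in> K}.
        \<Sum>w\<in>{w. w \<notin> insert v T \<and> insert w (insert v T) \<in> K}. f (v, w))"
      using T by (simp add: boundary_def f_def sum_distrib_left mult.assoc)
    also have "\<dots> = sum f P"
      unfolding P_def using finite_cofaces by (subst sum.Sigma) (auto simp del: insert_iff)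
    finally have eq: "boundary K (boundary K c) T = sum f P" .
    have P_iff: "(v, w) \<in> P \<longleftrightarrow> v \<notin> T \<and> w \<notin> T \<and> v \<noteq> w \<and> insert w (insert v T) \<in> K" for v w
      unfolding P_def using down_closed by auto
    have "sum f P = sum (f \<circ> prod.swap) P"
    proof (rule sum.reindex_bij_witness[of _ prod.swap prod.swap])
      fix x assume "x \<in> P"
      then show "prod.swap x \<in> P" by (cases x) (auto simp: P_iff insert_commute)
      then show "prod.swap x \<in> P" .
    qed auto
    also have "\<dots> = sum (\<lambda>x. - f x) P"
    proof (rule sum.cong)
      fix x assume x: "x \<in> P"
      obtain v w where vw: "x = (v, w)" by (cases x)
      have "v \<notin> T" "w \<notin> T" "v \<noteq> w" using x vw P_iff by auto
      then have "(-1::int) ^ card {x\<in>T. x < w} * (-1) ^ card {x\<in>insert w T. x < v}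
        = - ((-1) ^ card {x\<in>T. x < v} * (-1) ^ card {x\<in>insert v T. x < w})"
        using boundary_sgn_swap[OF finite_simplex[OF T], of w v] by simp
      then show "(f \<circ> prod.swap) x = - f x"
        unfolding vw f_def by (simp add: insert_commute)
    qed simp
    finally show ?thesis using eq by (simp add: sum_negf)
  qed
qed

text \<open>A quotient is trivial iff every coset equals the subgroup itself, and the coset of a
  cycle does so iff the cycle is a boundary.\<close>

lemma nontrivial_homology_iff:
  "carrier (reduced_homology K i) \<noteq> {\<one>\<^bsub>reduced_homology K i\<^esub>} \<longleftrightarrow> \<not> cycles K i \<subseteq> boundaries K i"
proof -
  let ?G = "(chain_group K i)\<lparr>carrier := cycles K i\<rparr>"
  have coset: "boundaries K i #>\<^bsub>?G\<^esub> a = {(\<lambda>S. h S + a S) | h. h \<in> boundaries K i}" for a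
    by (auto simp: r_coset_def chain_group_def)
  have carr: "carrier (reduced_homology K i) = {boundaries K i #>\<^bsub>?G\<^esub> a | a. a \<in> cycles K i}"
    by (auto simp: reduced_homology_def FactGroup_def RCOSETS_def)
  have one: "\<one>\<^bsub>reduced_homology K i\<^esub> = boundaries K i"
    by (simp add: reduced_homology_def FactGroup_def)
  have zc: "(\<lambda>S. 0) \<in> cycles K i" by (auto simp: cycles_def mem_chain_group_iff boundary_zero)
  have zb: "(\<lambda>S. 0) \<in> boundaries K i"
    unfolding boundaries_def by (rule image_eqI[of _ _ "\<lambda>S. 0"]) (auto simp: mem_chain_group_iff boundary_zero)
  have comb: "(\<lambda>S. a S - s * b S) \<in> boundaries K i" if ab: "a \<in> boundaries K i" "b \<in> boundaries K i" for a b s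
  proof -
    obtain a' b' where "a = boundary K a'" "b = boundary K b'"
      "a' \<in> carrier (chain_group K (i + 1))" "b' \<in> carrier (chain_group K (i + 1))"
      using ab unfolding boundaries_def by auto
    then have "(\<lambda>S. a S - s * b S) = boundary K (\<lambda>S. a' S - s * b' S)"
      "(\<lambda>S. a' S - s * b' S) \<in> carrier (chain_group K (i + 1))"
      by (simp_all only: boundary_diff chain_group_diff)
    then show ?thesis unfolding boundaries_def by (rule image_eqI)
  qed
  have coset_eq: "boundaries K i #>\<^bsub>?G\<^esub> a = boundaries K i \<longleftrightarrow> a \<in> boundaries K i" for a
  proof
    assume "boundaries K i #>\<^bsub>?G\<^esub> a = boundaries K i"
    moreover have "a \<in> boundaries K i #>\<^bsub>?G\<^esub> a" unfolding coset using zb by (auto intro!: exI[of _ "\<lambda>S. 0"])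
    ultimately show "a \<in> boundaries K i" by simp
  next
    assume a: "a \<in> boundaries K i"
    show "boundaries K i #>\<^bsub>?G\<^esub> a = boundaries K i"
    proof
      show "boundaries K i #>\<^bsub>?G\<^esub> a \<subseteq> boundaries K i"
      proof
        fix x assume "x \<in> boundaries K i #>\<^bsub>?G\<^esub> a"
        then obtain h where "x = (\<lambda>S. h S + a S)" "h \<in> boundaries K i" unfolding coset by blast
        then show "x \<in> boundaries K i" using comb[OF _ a, of h "-1"] by simp
      qed
      show "boundaries K i \<subseteq> boundaries K i #>\<^bsub>?G\<^esub> a"
      proof
        fix h assume "h \<in> boundaries K i"
        then have "(\<lambda>S. h S - a S) \<in> boundaries K i" using comb[OF _ a, of h 1] by simp
        moreover have "h = (\<lambda>S. (h S - a S) + a S)" by simp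
        ultimately show "h \<in> boundaries K i #>\<^bsub>?G\<^esub> a"
          unfolding coset by (intro CollectI exI[of _ "\<lambda>S. h S - a S"] conjI)
      qed
    qed
  qed
  have "{f a |a. a \<in> C} = {h} \<longleftrightarrow> (\<forall>a\<in>C. f a = h)" if "z \<in> C"
    for f :: "'b \<Rightarrow> 'c" and C h z
    using that by (auto simp: set_eq_iff)
  from this[OF zc] have "carrier (reduced_homology K i) = {\<one>\<^bsub>reduced_homology K i\<^esub>} \<longleftrightarrow>
    (\<forall>a\<in>cycles K i. boundaries K i #>\<^bsub>?G\<^esub> a = boundaries K i)"
    unfolding carr one .
  then show ?thesis unfolding coset_eq by blast
qed

end

text \<open>The key certifies acyclicity: along a gradient path it strictly decreases, since two nested
  simplices with equal keys are toggled at the same vertex.\<close>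

locale morse_matching = finite_complex K for K :: "'a::linorder set set" +
  fixes toggle :: "'a set \<Rightarrow> 'a option" and key :: "'a set \<Rightarrow> 'k::linorder"
  assumes flip_in: "S \<in> K \<Longrightarrow> toggle S = Some v \<Longrightarrow> flip v S \<in> K"
    and toggle_flip: "S \<in> K \<Longrightarrow> toggle S = Some v \<Longrightarrow> toggle (flip v S) = Some v"
    and key_flip: "S \<in> K \<Longrightarrow> toggle S = Some v \<Longrightarrow> key (flip v S) = key S"
    and key_mono: "insert w S \<in> K \<Longrightarrow> w \<notin> S \<Longrightarrow> toggle S = Some u \<Longrightarrow> toggle (insert w S) = Some v
      \<Longrightarrow> key S < key (insert w S) \<or> key S = key (insert w S) \<and> u = v"
begin

text \<open>The smaller members of the matched pairs; \<open>upper\<close> collects the larger ones,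
  and simplices with \<open>toggle S = None\<close> are critical.\<close>

definition lower :: "'a set \<Rightarrow> bool" where
  "lower S \<longleftrightarrow> S \<in> K \<and> (\<exists>v. toggle S = Some v \<and> v \<notin> S)"

definition upper :: "'a set \<Rightarrow> bool" where
  "upper S \<longleftrightarrow> S \<in> K \<and> (\<exists>v. toggle S = Some v \<and> v \<in> S)"

text \<open>Gaussian elimination, triangular with respect to the key. At a simplex \<open>S\<close>
  of maximal key in \<open>N\<close>, a multiple of the boundary of its partner cancels the
  coefficient of \<open>c\<close>; the other lower simplices in that boundary have smaller keys. As
  \<open>N\<close> is closed under passing to smaller keys, \<open>N - {S}\<close> still contains
  the lower part of the support.\<close>

lemma eliminate_lower_aux:
  assumes "finite N" and "\<And>S. S \<in> N \<Longrightarrow> lower S \<and> int (card S) = i + 1"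
    and "\<And>S S'. S \<in> N \<Longrightarrow> lower S' \<Longrightarrow> int (card S') = i + 1 \<Longrightarrow> key S' < key S \<Longrightarrow> S' \<in> N"
    and "c \<in> carrier (chain_group K i)"
    and "\<And>S. lower S \<Longrightarrow> c S \<noteq> 0 \<Longrightarrow> S \<in> N"
  shows "\<exists>e \<in> carrier (chain_group K (i + 1)). (\<forall>S. e S \<noteq> 0 \<longrightarrow> upper S) \<and>
    (\<forall>S. lower S \<longrightarrow> c S - boundary K e S = 0)"
  using assms
proof (induction "card N" arbitrary: N c)
  case 0
  then have "N = {}" by simp
  then have "c S = 0" if "lower S" for S using 0(6)[OF that] by auto
  then show ?case by (intro bexI[of _ "\<lambda>S. 0"]) (simp_all add: boundary_zero mem_chain_group_iff)
next
  case (Suc m)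
  have ne: "N \<noteq> {}" using Suc(2) by auto
  have "Max (key ` N) \<in> key ` N" using Suc(3) ne by (intro Max_in) auto
  then obtain S where S: "S \<in> N" "key S = Max (key ` N)" by auto
  have Smax: "key S' \<le> key S" if "S' \<in> N" for S' unfolding S(2) using Suc(3) that by simp
  obtain v where SK: "S \<in> K" and v: "toggle S = Some v" "v \<notin> S" and cS: "int (card S) = i + 1"
    using Suc.prems(2)[OF S(1)] unfolding lower_def by auto
  define T where "T = insert v S"
  have flipS: "flip v S = T" by (simp add: flip_def T_def v)
  have TK: "T \<in> K" and tT: "toggle T = Some v" and kT: "key T = key S"
    using flip_in[OF SK v(1)] toggle_flip[OF SK v(1)] key_flip[OF SK v(1)] unfolding flipS by auto
  define s where "s = (-1::int) ^ card {w\<in>S. w < v}"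
  have ss: "s * s = 1" unfolding s_def by (simp flip: power_mult_distrib)
  define \<delta> where "\<delta> = (\<lambda>U. if U = T then 1 else (0::int))"
  have d\<delta>: "\<delta> \<in> carrier (chain_group K (i + 1))"
    unfolding mem_chain_group_iff \<delta>_def using TK cS finite_simplex[OF SK] v(2) by (auto simp: T_def)
  have bS: "boundary K \<delta> S = s"
  proof -
    have "(\<Sum>x\<in>{v. v \<notin> S \<and> insert v S \<in> K}. (-1) ^ card {w\<in>S. w < x} * \<delta> (insert x S))
      = (\<Sum>x\<in>{v. v \<notin> S \<and> insert v S \<in> K}. if x = v then s else 0)"
      by (rule sum.cong) (use v(2) in \<open>auto simp: \<delta>_def T_def s_def\<close>)
    also have "\<dots> = s" using finite_cofaces v(2) TK by (subst sum.delta) (auto simp: T_def)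
    finally show ?thesis using SK by (simp add: boundary_def)
  qed
  have bX: "\<exists>w. w \<notin> U \<and> insert w U = T" if "boundary K \<delta> U \<noteq> 0" for U
  proof (rule ccontr)
    assume "\<not> ?thesis"
    then have "boundary K \<delta> U = 0" by (auto simp: boundary_def \<delta>_def intro!: sum.neutral)
    then show False using that by simp
  qed
  \<comment> \<open>The boundary of \<open>\<delta>\<close> has coefficient \<open>s\<close> at
    \<open>S\<close>, and \<open>s * s = 1\<close>, so \<open>c'\<close> vanishes there.\<close>
  define c' where "c' = (\<lambda>U. c U - (c S * s) * boundary K \<delta> U)"
  have c': "c' \<in> carrier (chain_group K i)"
    unfolding c'_def using Suc.prems(4) boundary_in_chain_group[OF d\<delta>] by (intro chain_group_diff) auto
  have sub: "U \<in> N - {S}" if U: "lower U" "c' U \<noteq> 0" for U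
  proof -
    have "U \<noteq> S" using U(2) bS ss unfolding c'_def by (auto simp: mult.assoc)
    moreover have "U \<in> N"
    proof (cases "c U = 0")
      case False then show ?thesis using Suc.prems(5) U by blast
    next
      case True
      then have "boundary K \<delta> U \<noteq> 0" using U(2) unfolding c'_def by auto
      then obtain w where w: "w \<notin> U" "insert w U = T" using bX by blast
      obtain u where u: "toggle U = Some u" "u \<notin> U" using U(1) lower_def by auto
      \<comment> \<open>With equal keys \<open>U\<close> and \<open>T\<close> would be toggled at
        the same vertex \<open>v\<close>; as \<open>U\<close> is lower, it lacks \<open>v\<close>,
        and the only facet of \<open>T\<close> lacking \<open>v\<close> is \<open>S\<close>.\<close>
      have "key U < key T \<or> (key U = key T \<and> u = v)" using key_mono[of w U u v] w TK u tT by auto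
      moreover have "u \<noteq> v"
      proof
        assume "u = v"
        then have "v \<notin> U" using u(2) by simp
        moreover have "v \<in> insert w U" using w(2) T_def by simp
        ultimately have "v \<notin> U" "w = v" by simp_all
        then have "U = S" using w(2) v(2) insert_ident[of v U S] unfolding T_def by simp
        then show False using \<open>U \<noteq> S\<close> by simp
      qed
      ultimately have "key U < key S" using kT by auto
      moreover have "int (card U) = i + 1" using c' U(2) mem_chain_group_iff by blast
      ultimately show ?thesis using Suc.prems(3)[OF S(1) U(1)] by blast
    qed
    ultimately show ?thesis by simp
  qed
  have "\<exists>e \<in> carrier (chain_group K (i + 1)). (\<forall>S. e S \<noteq> 0 \<longrightarrow> upper S) \<and>
    (\<forall>S. lower S \<longrightarrow> c' S - boundary K e S = 0)"
  proof (rule Suc(1)[of "N - {S}"])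
    show "m = card (N - {S})" using Suc(2,3) S by simp
    show "finite (N - {S})" using Suc(3) by simp
    show "U \<in> N - {S} \<Longrightarrow> lower U \<and> int (card U) = i + 1" for U using Suc.prems(2) by simp
    show "S' \<in> N - {S}" if "U \<in> N - {S}" "lower S'" "int (card S') = i + 1" "key S' < key U" for U S'
    proof -
      have "S' \<in> N" using Suc.prems(3)[of U S'] that by simp
      moreover have "\<not> key S < key U" using Smax[of U] that(1) by (simp add: not_less)
      then have "S' \<noteq> S" using that(4) by blast
      ultimately show ?thesis by simp
    qed
  qed (use c' sub in auto)
  then obtain e where e: "e \<in> carrier (chain_group K (i + 1))" "\<And>S. e S \<noteq> 0 \<Longrightarrow> upper S"
    "\<And>S. lower S \<Longrightarrow> c' S - boundary K e S = 0" by blast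
  define e' where "e' = (\<lambda>U. e U - (- (c S * s)) * \<delta> U)"
  have "upper T" unfolding upper_def using TK tT by (auto simp: T_def)
  show ?case
  proof (intro bexI[of _ e'] conjI allI impI)
    show "e' \<in> carrier (chain_group K (i + 1))" unfolding e'_def by (rule chain_group_diff[OF e(1) d\<delta>])
    show "upper U" if "e' U \<noteq> 0" for U using that e(2)[of U] \<open>upper T\<close> unfolding e'_def \<delta>_def
      by (auto split: if_splits)
    show "c U - boundary K e' U = 0" if "lower U" for U
      using e(3)[OF that] unfolding e'_def boundary_diff c'_def by simp
  qed
qed

lemma eliminate_lower:
  assumes "c \<in> carrier (chain_group K i)"
  obtains e where "e \<in> carrier (chain_group K (i + 1))" "\<And>S. e S \<noteq> 0 \<Longrightarrow> upper S"
    "\<And>S. lower S \<Longrightarrow> c S = boundary K e S"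
proof -
  let ?N = "{S. lower S \<and> int (card S) = i + 1}"
  have "finite ?N" by (rule finite_subset[OF _ finite_K]) (auto simp: lower_def)
  moreover have "S \<in> ?N" if "lower S" "c S \<noteq> 0" for S
    using that assms unfolding mem_chain_group_iff by blast
  ultimately obtain e where "e \<in> carrier (chain_group K (i + 1))" "\<forall>S. e S \<noteq> 0 \<longrightarrow> upper S"
    "\<forall>S. lower S \<longrightarrow> c S - boundary K e S = 0"
    using eliminate_lower_aux[of ?N i c] assms by blast
  then show ?thesis using that[of e] by simp
qed

text \<open>Let \<open>T\<close> have maximal key in the support and let \<open>S\<close> be its
  lower partner. Any other upper coface of \<open>S\<close> has a key above that of
  \<open>T\<close>, hence coefficient 0, so the boundary at \<open>S\<close> is the coefficient of
  \<open>T\<close> up to sign.\<close>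

lemma chain_eq_zero:
  assumes c: "c \<in> carrier (chain_group K i)" and up: "\<And>S. c S \<noteq> 0 \<Longrightarrow> upper S"
    and bd: "\<And>S. lower S \<Longrightarrow> boundary K c S = 0"
  shows "c = (\<lambda>S. 0)"
proof (rule ccontr)
  assume "c \<noteq> (\<lambda>S. 0)"
  then have ne: "{S. c S \<noteq> 0} \<noteq> {}" by auto
  have fin: "finite {S. c S \<noteq> 0}" by (rule finite_subset[OF _ finite_K]) (use up upper_def in auto)
  have "Max (key ` {S. c S \<noteq> 0}) \<in> key ` {S. c S \<noteq> 0}" using ne fin by (intro Max_in) auto
  then obtain T where T: "c T \<noteq> 0" "key T = Max (key ` {S. c S \<noteq> 0})" by auto
  then have Tmax: "key T' \<le> key T" if "c T' \<noteq> 0" for T' using fin that by simp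
  obtain v where TK: "T \<in> K" and v: "toggle T = Some v" "v \<in> T" using up[OF T(1)] upper_def by auto
  define S where "S = T - {v}"
  have flipT: "flip v T = S" by (simp add: flip_def S_def v)
  have SK: "S \<in> K" and tS: "toggle S = Some v" and kS: "key S = key T"
    using flip_in[OF TK v(1)] toggle_flip[OF TK v(1)] key_flip[OF TK v(1)] unfolding flipT by auto
  have low: "lower S" unfolding lower_def using SK tS by (auto simp: S_def)
  have T_eq: "insert v S = T" "v \<notin> S" using v by (auto simp: S_def)
  have "c (insert w S) = 0" if w: "w \<notin> S" "w \<noteq> v" for w
  proof (rule ccontr)
    assume nz: "c (insert w S) \<noteq> 0"
    then obtain u where u: "insert w S \<in> K" "toggle (insert w S) = Some u" "u \<in> insert w S"
      using up upper_def by metis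
    have "key S < key (insert w S) \<or> key S = key (insert w S) \<and> v = u"
      using key_mono[OF u(1) w(1) tS u(2)] .
    moreover have "v \<noteq> u" using u(3) w T_eq by auto
    ultimately show False using Tmax[OF nz] kS by auto
  qed
  then have "(\<Sum>x\<in>{v. v \<notin> S \<and> insert v S \<in> K}. (-1) ^ card {w\<in>S. w < x} * c (insert x S))
      = (\<Sum>x\<in>{v. v \<notin> S \<and> insert v S \<in> K}. if x = v then (-1) ^ card {w\<in>S. w < v} * c T else 0)"
    using T_eq by (intro sum.cong) auto
  also have "\<dots> = (-1) ^ card {w\<in>S. w < v} * c T"
    using finite_cofaces T_eq TK by (subst sum.delta) auto
  finally have "boundary K c S \<noteq> 0" using SK T(1) by (simp add: boundary_def)
  then show False using bd[OF low] by simp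
qed

lemma not_critical: "S \<in> K \<Longrightarrow> toggle S \<noteq> None \<Longrightarrow> lower S \<or> upper S"
  unfolding lower_def upper_def by auto

text \<open>Once the lower part is eliminated, the remaining cycle is supported on upper simplices,
  since none of this size is critical, and is therefore zero. The support of \<open>e\<close> on
  upper simplices matters later, as it avoids critical ones.\<close>

lemma eliminate_cycle:
  assumes c: "c \<in> cycles K i"
    and ncrit: "\<And>S. S \<in> K \<Longrightarrow> int (card S) = i + 1 \<Longrightarrow> toggle S \<noteq> None"
  obtains e where "e \<in> carrier (chain_group K (i + 1))" "\<And>S. e S \<noteq> 0 \<Longrightarrow> upper S" "c = boundary K e"
proof -
  have cc: "c \<in> carrier (chain_group K i)" and bc: "boundary K c = (\<lambda>S. 0)"
    using c by (auto simp: cycles_def)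
  obtain e where e: "e \<in> carrier (chain_group K (i + 1))" "\<And>S. e S \<noteq> 0 \<Longrightarrow> upper S"
    "\<And>S. lower S \<Longrightarrow> c S = boundary K e S" using eliminate_lower[OF cc] by blast
  define c' where "c' = (\<lambda>S. c S - 1 * boundary K e S)"
  have c': "c' \<in> carrier (chain_group K i)" unfolding c'_def
    using boundary_in_chain_group[OF e(1)] cc by (intro chain_group_diff) auto
  have "c' = (\<lambda>S. 0)"
  proof (rule chain_eq_zero[OF c'])
    show "upper S" if "c' S \<noteq> 0" for S
    proof -
      have "S \<in> K" "int (card S) = i + 1" using c' that mem_chain_group_iff by blast+
      moreover have "\<not> lower S" using e(3) that by (auto simp: c'_def)
      ultimately show ?thesis using not_critical ncrit by blast
    qed
    show "boundary K c' S = 0" for S unfolding c'_def boundary_diff by (simp add: bc boundary_boundary)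
  qed
  then have "c = boundary K e" unfolding c'_def by (simp add: fun_eq_iff)
  then show ?thesis using that e by blast
qed

theorem trivial_homology:
  assumes "\<And>S. S \<in> K \<Longrightarrow> int (card S) = i + 1 \<Longrightarrow> toggle S \<noteq> None"
  shows "cycles K i \<subseteq> boundaries K i"
  using eliminate_cycle[OF _ assms] unfolding boundaries_def by blast

text \<open>As dimension \<open>i - 1\<close> has no critical simplices, \<open>S\<close> is
  completed to a cycle \<open>z\<close> by upper simplices, so \<open>z\<close> has coefficient 1 at
  \<open>S\<close>. If \<open>z\<close> bounded a chain, that chain could be freed of lower
  simplices; having no critical ones either, it would be zero by
  \<open>chain_eq_zero\<close>.\<close>

theorem nontrivial_homology:
  assumes S: "S \<in> K" "int (card S) = i + 1" "toggle S = None"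
    and down: "\<And>S. S \<in> K \<Longrightarrow> int (card S) = i \<Longrightarrow> toggle S \<noteq> None"
    and up: "\<And>S. S \<in> K \<Longrightarrow> int (card S) = i + 2 \<Longrightarrow> toggle S \<noteq> None"
  shows "\<not> cycles K i \<subseteq> boundaries K i"
proof
  assume sub: "cycles K i \<subseteq> boundaries K i"
  define \<delta> where "\<delta> = (\<lambda>U. if U = S then 1 else (0::int))"
  have \<delta>: "\<delta> \<in> carrier (chain_group K i)" using S unfolding mem_chain_group_iff \<delta>_def by auto
  have "boundary K \<delta> \<in> cycles K (i - 1)"
    using boundary_in_chain_group[OF \<delta>] boundary_boundary by (simp add: cycles_def)
  from eliminate_cycle[OF this] down obtain e where e: "e \<in> carrier (chain_group K i)"
    "\<And>S. e S \<noteq> 0 \<Longrightarrow> upper S" "boundary K \<delta> = boundary K e" by auto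
  define z where "z = (\<lambda>U. \<delta> U - 1 * e U)"
  have z: "z \<in> carrier (chain_group K i)" unfolding z_def by (rule chain_group_diff[OF \<delta> e(1)])
  have "boundary K z = (\<lambda>S. 0)" unfolding z_def boundary_diff e(3) by simp
  then have "z \<in> boundaries K i" using sub z by (auto simp: cycles_def)
  then obtain b where b: "b \<in> carrier (chain_group K (i + 1))" "z = boundary K b"
    unfolding boundaries_def by auto
  obtain g where g: "g \<in> carrier (chain_group K (i + 1 + 1))" "\<And>S. g S \<noteq> 0 \<Longrightarrow> upper S"
    "\<And>S. lower S \<Longrightarrow> b S = boundary K g S" using eliminate_lower[OF b(1)] by blast
  define b' where "b' = (\<lambda>U. b U - 1 * boundary K g U)"
  have b': "b' \<in> carrier (chain_group K (i + 1))" unfolding b'_def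
    using boundary_in_chain_group[OF g(1)] b by (intro chain_group_diff) (simp_all add: add.commute)
  have bb': "boundary K b' = z" unfolding b'_def boundary_diff b(2) by (simp add: boundary_boundary)
  have not_upper_lower: "\<not> (upper U \<and> lower U)" for U unfolding upper_def lower_def by auto
  have "b' = (\<lambda>S. 0)"
  proof (rule chain_eq_zero[OF b'])
    show "upper U" if "b' U \<noteq> 0" for U
    proof -
      have "U \<in> K" "int (card U) = i + 2" using b' that mem_chain_group_iff[of b' K] by auto
      moreover have "\<not> lower U" using g(3) that by (auto simp: b'_def)
      ultimately show ?thesis using not_critical up by blast
    qed
    show "boundary K b' U = 0" if "lower U" for U
      \<comment> \<open>\<open>z\<close> vanishes on lower simplices: \<open>S\<close> is critical
        and \<open>e\<close> lives on upper ones.\<close>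
      using that S(3) e(2)[of U] not_upper_lower[of U] unfolding bb' z_def \<delta>_def by (auto simp: lower_def)
  qed
  then have "z S = 0" using bb' boundary_zero by metis
  moreover have "e S = 0" using e(2)[of S] S(3) by (auto simp: upper_def)
  ultimately show False by (simp add: z_def \<delta>_def)
qed

end

section \<open>A decision tree for the 4-cube\<close>

text \<open>Vertices of the 4-cube are the numbers below 16, read in binary, so \<open>15 - x\<close> is the antipode
  of \<open>x\<close>; \<open>far u\<close> lists the vertices at distance at least 3 from \<open>u\<close>.\<close>

definition far :: "nat \<Rightarrow> nat list" where
  "far u = [[7, 11, 13, 14, 15], [6, 10, 12, 14, 15], [5, 9, 12, 13, 15], [4, 8, 12, 13, 14],
    [3, 9, 10, 11, 15], [2, 8, 10, 11, 14], [1, 8, 9, 11, 13], [0, 8, 9, 10, 12],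
    [3, 5, 6, 7, 15], [2, 4, 6, 7, 14], [1, 4, 5, 7, 13], [0, 4, 5, 6, 12],
    [1, 2, 3, 7, 11], [0, 2, 3, 6, 10], [0, 1, 3, 5, 9], [0, 1, 2, 4, 8]] ! u"

text \<open>The simplices of the 4-cube at scale 3 (no antipodal pair) that lie in no ball of radius
  2.\<close>

definition wide :: "nat set \<Rightarrow> bool" where
  "wide M \<longleftrightarrow> M \<subseteq> {..<16} \<and> (\<forall>x\<in>M. 15 - x \<notin> M) \<and> (\<forall>u<16. \<exists>x\<in>M. x \<in> set (far u))"

lemma less_16: "(u::nat) < 16 \<Longrightarrow>
  u \<in> {0, 1, 2, 3, 4, 5, 6, 7, 8, 9, 10, 11, 12, 13, 14, 15}"
  by (simp, presburger)

lemma far_sym: "u < 16 \<Longrightarrow> x \<in> set (far u) \<Longrightarrow> u \<in> set (far x)"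
  by (drule less_16) (elim insertE emptyE; simp add: far_def; elim disjE; simp)

text \<open>The left subtree of \<open>Split v\<close> is for the sets not containing \<open>v\<close>. In \<open>valid A B t\<close>, the lists
  \<open>A\<close> and \<open>B\<close> hold the vertices already decided to lie inside and outside the set.\<close>

datatype tree = Split nat tree tree | Pivot nat | Crit | Void

primrec pivot :: "tree \<Rightarrow> nat set \<Rightarrow> nat option" where
  "pivot (Split v l r) M = (if v \<in> M then pivot r M else pivot l M)"
| "pivot (Pivot v) M = Some v"
| "pivot Crit M = None"
| "pivot Void M = None"

text \<open>The sequence of answers at the splits, to be compared lexicographically as the tail of
  \<open>key\<close>.\<close>

primrec branch :: "tree \<Rightarrow> nat set \<Rightarrow> nat list" where
  "branch (Split v l r) M = (if v \<in> M then 1 # branch r M else 0 # branch l M)"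
| "branch (Pivot v) M = []"
| "branch Crit M = []"
| "branch Void M = []"

primrec valid :: "nat list \<Rightarrow> nat list \<Rightarrow> tree \<Rightarrow> bool" where
  "valid A B (Split v l r) \<longleftrightarrow> valid A (v # B) l \<and> valid (v # A) B r"
| "valid A B (Pivot v) \<longleftrightarrow> v < 16 \<and> v \<notin> set A \<and> v \<notin> set B \<and> 15 - v \<in> set B \<and>
     (\<forall>u\<in>set (far v). \<exists>x\<in>set (far u). x \<in> set A)"
| "valid A B Crit \<longleftrightarrow> (\<forall>v\<in>{..<16}. v \<in> set A \<or> v \<in> set B) \<and> card (set A) \<in> {5, 8}"
| "valid A B Void \<longleftrightarrow> (\<exists>x\<in>set A. 15 - x \<in> set A) \<or> (\<exists>u\<in>{..<16}. \<forall>x\<in>set (far u). x \<in> set B)"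

text \<open>At the first split that separates \<open>M\<close> from \<open>N\<close>, the vertex
  lies in \<open>N\<close> only, so \<open>N\<close> has the larger answer; without such a split
  both reach the same leaf.\<close>

lemma branch_mono:
  "M \<subseteq> N \<Longrightarrow> branch t M < branch t N \<or> branch t M = branch t N \<and> pivot t M = pivot t N"
proof (induction t)
  case (Split v l r)
  then show ?case by (cases "v \<in> M"; cases "v \<in> N") auto
qed auto

text \<open>Toggling \<open>v\<close> can create an antipodal pair only with \<open>15 - v\<close>,
  and only centers far from \<open>v\<close> can lose their witness; \<open>dom\<close> gives these
  another one.\<close>

lemma wide_flip:
  assumes M: "wide M" and v: "v < 16" "15 - v \<notin> M"
    and dom: "\<And>u. u \<in> set (far v) \<Longrightarrow> \<exists>x\<in>M - {v}. x \<in> set (far u)"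
  shows "wide (flip v M)"
proof -
  have sub: "M - {v} \<subseteq> flip v M" "flip v M \<subseteq> insert v M" by (auto simp: flip_def)
  have "15 - x \<notin> flip v M" if "x \<in> flip v M" for x
  proof
    assume a: "15 - x \<in> flip v M"
    have "x < 16" using that sub(2) M v(1) unfolding wide_def by auto
    then have xx: "15 - (15 - x) = x" and "15 - x \<noteq> x" by presburger+
    show False
    proof (cases "x = v \<or> 15 - x = v")
      case True
      then show False
        using a that v(2) sub(2) xx \<open>15 - x \<noteq> x\<close> by (metis insertE subsetD)
    next
      case False
      then have "x \<in> M" "15 - x \<in> M" using a that sub(2) by auto
      then show False using M unfolding wide_def by blast
    qed
  qed
  moreover have "\<exists>x\<in>flip v M. x \<in> set (far u)" if u: "u < 16" for u
  proof (cases "u \<in> set (far v)")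
    case True
    then show ?thesis using dom sub(1) by blast
  next
    case False
    obtain x where "x \<in> M" "x \<in> set (far u)" using M u unfolding wide_def by blast
    then show ?thesis using False far_sym[OF u] sub(1) by (intro bexI[of _ x]) auto
  qed
  moreover have "flip v M \<subseteq> {..<16}" using M v(1) sub(2) unfolding wide_def by auto
  ultimately show ?thesis unfolding wide_def by blast
qed

text \<open>The pivot is undecided on its branch, so toggling it leads to the same leaf. Its
  antipode is decided to be outside, and the vertices decided to be inside already serve all centers
  far from it, so \<open>wide_flip\<close> applies.\<close>

lemma valid_pivot_Some:
  assumes "valid A B t" "wide M" "set A \<subseteq> M" "set B \<inter> M = {}" "pivot t M = Some v"
  shows "v < 16 \<and> v \<notin> set A \<and> v \<notin> set B \<and> wide (flip v M) \<and> pivot t (flip v M) = Some v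
    \<and> branch t (flip v M) = branch t M"
  using assms
proof (induction t arbitrary: A B)
  case (Split w l r)
  have in_flip: "w \<in> flip v M \<longleftrightarrow> w \<in> M" if "v \<noteq> w" using that by (auto simp: flip_def)
  show ?case
  proof (cases "w \<in> M")
    case True
    then show ?thesis using Split.IH(2)[of "w # A" B] Split.prems in_flip by auto
  next
    case False
    then show ?thesis using Split.IH(1)[of A "w # B"] Split.prems in_flip by auto
  qed
next
  case (Pivot w)
  then have [simp]: "w = v" by simp
  have "wide (flip v M)"
  proof (rule wide_flip[OF Pivot.prems(2)])
    show "v < 16" "15 - v \<notin> M" using Pivot.prems by auto
    show "\<exists>x\<in>M - {v}. x \<in> set (far u)" if "u \<in> set (far v)" for u
      using Pivot.prems that by (auto 4 4)
  qed
  then show ?case using Pivot.prems by auto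
qed auto

text \<open>At \<open>Crit\<close> all vertices are decided, so \<open>M = set A\<close>. At
  \<open>Void\<close> the decisions alone contain an antipodal pair or exclude all of some
  \<open>far u\<close>, so no wide set arrives there.\<close>

lemma valid_pivot_None:
  assumes "valid A B t" "wide M" "set A \<subseteq> M" "set B \<inter> M = {}" "pivot t M = None"
  shows "card M \<in> {5, 8}"
  using assms
proof (induction t arbitrary: A B)
  case (Split w l r)
  show ?case
  proof (cases "w \<in> M")
    case True
    then show ?thesis using Split.IH(2)[of "w # A" B] Split.prems by auto
  next
    case False
    then show ?thesis using Split.IH(1)[of A "w # B"] Split.prems by auto
  qed
next
  case Crit
  have "M \<subseteq> set A" using Crit.prems unfolding wide_def by auto
  then have "M = set A" using Crit.prems(3) by blast
  then show ?case using Crit.prems(1) by simp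
next
  case Void
  have "\<forall>x\<in>set A. 15 - x \<notin> set A" using Void.prems(2,3) unfolding wide_def by blast
  then obtain u where "u < 16" "\<forall>x\<in>set (far u). x \<in> set B" using Void.prems(1) by auto
  then show ?case using Void.prems(2,4) unfolding wide_def by blast
qed auto

text \<open>Found by computer search, splitting first on the vertices of even weight.\<close>

definition cube_tree :: tree where
  "cube_tree =
   Split 15 (Split 3 (Split 5 (Split 6 (Split 9 (Split 10 (Split 12 (Split 7 Void (Split 8 (Split
   11 Void (Split 4 (Split 13 Void (Split 2 (Split 14 Void (Split 1 (Split 0 Void Crit) Void))
   Void)) Void)) Void)) (Split 7 Void (Split 1 (Split 11 Void (Pivot 14)) (Split 2 (Pivot 13)
   (Pivot 0))))) (Split 12 (Split 7 Void (Split 1 (Split 13 Void (Pivot 14)) (Split 4 (Pivot 11)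
   (Pivot 0)))) (Split 1 (Split 7 Void (Pivot 14)) (Pivot 0)))) (Split 10 (Split 12 (Split 7 Void
   (Split 2 (Split 14 Void (Pivot 13)) (Split 4 (Pivot 11) (Pivot 0)))) (Split 2 (Split 7 Void
   (Pivot 13)) (Pivot 0))) (Split 12 (Split 4 (Split 7 Void (Pivot 11)) (Pivot 0)) (Split 1 (Split
   7 Void (Pivot 14)) (Pivot 0))))) (Split 9 (Split 10 (Split 12 (Split 11 Void (Split 1 (Split 13
   Void (Pivot 14)) (Split 8 (Pivot 7) (Pivot 0)))) (Split 1 (Split 11 Void (Pivot 14)) (Pivot
   0))) (Split 12 (Split 1 (Split 13 Void (Pivot 14)) (Pivot 0)) (Split 1 (Split 7 (Split 11
   (Split 2 Void (Split 13 (Split 4 Void (Split 8 Void (Split 14 Void (Split 0 Void Crit))))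
   Void)) (Pivot 14)) (Pivot 14)) (Pivot 0)))) Void)) (Split 6 (Split 9 (Split 10 (Split 12 (Split
   11 Void (Split 2 (Split 14 Void (Pivot 13)) (Split 8 (Pivot 7) (Pivot 0)))) (Split 2 (Split 11
   Void (Pivot 13)) (Pivot 0))) Void) (Split 10 (Split 12 (Split 2 (Split 14 Void (Pivot 13))
   (Pivot 0)) (Split 2 (Split 7 (Split 11 (Split 1 Void (Split 14 (Split 4 Void (Split 8 Void
   (Split 13 Void (Split 0 Void Crit)))) Void)) (Pivot 13)) (Pivot 13)) (Pivot 0))) Void)) (Split
   9 (Split 10 (Split 12 (Split 8 (Split 11 Void (Pivot 7)) (Pivot 0)) (Split 1 (Split 11 Void
   (Pivot 14)) (Pivot 0))) Void) Void))) (Split 5 (Split 6 (Split 9 (Split 10 (Split 12 (Split 13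
   Void (Split 4 (Split 14 Void (Pivot 11)) (Split 8 (Pivot 7) (Pivot 0)))) Void) (Split 12 (Split
   4 (Split 13 Void (Pivot 11)) (Pivot 0)) Void)) (Split 10 (Split 12 (Split 4 (Split 14 Void
   (Pivot 11)) (Pivot 0)) Void) (Split 12 (Split 4 (Split 7 (Split 13 (Split 1 Void (Split 14
   (Split 2 Void (Split 8 Void (Split 11 Void (Split 0 Void Crit)))) Void)) (Pivot 11)) (Pivot
   11)) (Pivot 0)) Void))) (Split 9 (Split 10 (Split 12 (Split 8 (Split 13 Void (Pivot 7)) (Pivot
   0)) Void) (Split 12 (Split 1 (Split 13 Void (Pivot 14)) (Pivot 0)) Void)) Void)) (Split 6
   (Split 9 (Split 10 (Split 12 (Split 8 (Split 14 Void (Pivot 7)) (Pivot 0)) Void) Void) (Split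
   10 (Split 12 (Split 2 (Split 14 Void (Pivot 13)) (Pivot 0)) Void) Void)) (Split 9 (Split 10
   (Split 12 (Split 8 (Split 11 (Split 13 (Split 1 Void (Split 14 (Split 2 Void (Split 4 Void
   (Split 7 Void (Split 0 Void Crit)))) Void)) (Pivot 7)) (Pivot 7)) (Pivot 0)) Void) Void)
   Void)))) (Split 12 (Split 0 (Split 5 (Split 6 (Split 9 (Split 10 (Split 4 Void (Split 1 (Split
   8 Void (Pivot 14)) (Split 2 (Pivot 13) (Pivot 3)))) (Split 1 (Split 4 Void (Pivot 14)) (Pivot
   3))) (Split 10 (Split 2 (Split 4 Void (Pivot 13)) (Pivot 3)) (Split 1 (Split 4 Void (Pivot 14))
   (Pivot 3)))) (Split 9 (Split 10 (Split 1 (Split 8 Void (Pivot 14)) (Pivot 3)) (Split 1 (Split 4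
   (Split 8 (Split 2 Void (Split 13 (Split 7 Void (Split 11 Void (Split 14 Void (Split 3 Void
   Crit)))) Void)) (Pivot 14)) (Pivot 14)) (Pivot 3))) Void)) (Split 6 (Split 9 (Split 10 (Split 2
   (Split 8 Void (Pivot 13)) (Pivot 3)) Void) (Split 10 (Split 2 (Split 4 (Split 8 (Split 1 Void
   (Split 14 (Split 7 Void (Split 11 Void (Split 13 Void (Split 3 Void Crit)))) Void)) (Pivot 13))
   (Pivot 13)) (Pivot 3)) Void)) (Split 9 (Split 10 (Split 1 (Split 8 Void (Pivot 14)) (Pivot 3))
   Void) Void))) Void) (Split 10 (Split 0 (Split 3 (Split 6 (Split 9 (Split 1 (Split 2 Void (Pivot
   14)) (Pivot 5)) (Split 1 (Split 2 Void (Pivot 14)) (Pivot 5))) (Split 9 (Split 1 (Split 2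
   (Split 8 (Split 4 Void (Split 11 (Split 7 Void (Split 13 Void (Split 14 Void (Split 5 Void
   Crit)))) Void)) (Pivot 14)) (Pivot 14)) (Pivot 5)) Void)) Void) Void) (Split 6 (Split 0 (Split
   3 (Split 5 (Split 1 (Split 2 (Split 4 (Split 7 (Split 8 Void (Split 11 Void (Split 13 Void
   (Split 14 Void (Split 9 Void Crit))))) (Pivot 14)) (Pivot 14)) (Pivot 14)) (Pivot 9)) Void)
   Void) Void) (Split 0 (Split 3 (Split 5 (Split 9 (Split 1 Void (Split 2 (Pivot 13) (Split 4
   (Pivot 11) (Split 7 (Pivot 8) (Split 8 (Split 11 (Split 13 (Split 14 Crit Void) Void) Void)
   Void))))) Void) Void) Void) Void))))"

lemma valid_cube_tree: "valid [] [] cube_tree"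
  by code_simp

section \<open>Simplices of the hypercube complex\<close>

definition diffs :: "bool list \<Rightarrow> bool list \<Rightarrow> nat set" where
  "diffs v w = {i. i < length v \<and> v ! i \<noteq> w ! i}"

lemma finite_diffs [simp]: "finite (diffs v w)"
  by (simp add: diffs_def)

lemma hamming_eq: "hamming v w = real (card (diffs v w))"
  by (simp add: hamming_def diffs_def)

text \<open>Entries are Boolean, so \<open>x\<close> and \<open>z\<close> differ exactly where one
  of them, but not both, differs from \<open>y\<close>. Seen from a base vertex, distances are sizes
  of symmetric differences.\<close>

lemma diffs_sym_diff:
  assumes "length x = length y" "length y = length z"
  shows "diffs x z = sym_diff (diffs y x) (diffs y z)"
  using assms by (auto simp: diffs_def)

text \<open>In the form used for the parity arguments.\<close>

lemma card_sym_diff: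
  assumes "finite A" "finite B"
  shows "card (sym_diff A B) + 2 * card (A \<inter> B) = card A + card B"
proof -
  have "card (sym_diff A B) = card (A - B) + card (B - A)"
    using assms by (intro card_Un_disjoint) auto
  moreover have "card A = card (A \<inter> B) + card (A - B)" "card B = card (A \<inter> B) + card (B - A)"
    using card_Int_Diff[OF assms(1), of B] card_Int_Diff[OF assms(2), of A] by (simp_all add: Int_commute)
  ultimately show ?thesis by simp
qed

lemma diffs_commute: "length x = length y \<Longrightarrow> diffs x y = diffs y x"
  by (auto simp: diffs_def)

lemma diffs_self [simp]: "diffs x x = {}"
  by (simp add: diffs_def)

lemma diffs_eq_empty_iff: "length x = length y \<Longrightarrow> diffs x y = {} \<longleftrightarrow> x = y"
  by (auto simp: diffs_def list_eq_iff_nth_eq)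

lemma hypercube_iff [simp]: "x \<in> hypercube n \<longleftrightarrow> length x = n"
  by (simp add: hypercube_def)

lemma finite_hypercube: "finite (hypercube n)"
proof -
  have "hypercube n = {v. set v \<subseteq> UNIV \<and> length v = n}" by (auto simp: hypercube_def)
  then show ?thesis using finite_lists_length_eq[of "UNIV :: bool set" n] by simp
qed

abbreviation VR :: "nat \<Rightarrow> bool list set set" where
  "VR n \<equiv> vr_complex (hypercube n) hamming 3"

lemma VR_iff: "S \<in> VR n \<longleftrightarrow> (\<forall>x\<in>S. length x = n) \<and> (\<forall>x\<in>S. \<forall>y\<in>S. card (diffs x y) \<le> 3)"
proof -
  have "finite S" if "\<forall>x\<in>S. length x = n"
    by (rule finite_subset[OF _ finite_hypercube[of n]]) (use that in auto)
  then show ?thesis by (auto simp: vr_complex_def hamming_eq)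
qed

lemma finite_VR: "S \<in> VR n \<Longrightarrow> finite S"
  by (simp add: vr_complex_def)

interpretation VR: finite_complex "VR n" for n
proof
  show "finite (VR n)"
    by (rule finite_subset[of _ "Pow (hypercube n)"]) (auto simp: vr_complex_def finite_hypercube)
  show "S \<in> VR n \<Longrightarrow> finite S" for S by (rule finite_VR)
  show "S \<in> VR n \<Longrightarrow> T \<subseteq> S \<Longrightarrow> T \<in> VR n" for S T unfolding VR_iff by blast
qed

text \<open>The disjunct \<open>n \<le> p\<close> sets the value \<open>n\<close> when no vertex has
  a False entry, as for the empty simplex.\<close>

definition lead :: "nat \<Rightarrow> bool list set \<Rightarrow> nat" where
  "lead n S = (LEAST p. n \<le> p \<or> (\<exists>x\<in>S. \<not> x ! p))"

text \<open>Phrased as the failure of the prefix condition of \<open>cand\<close>; by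
  \<open>low_iff\<close> these are the vertices False at the lead coordinate.\<close>

definition low :: "nat \<Rightarrow> bool list set \<Rightarrow> bool list set" where
  "low n S = {x\<in>S. \<exists>i<n. i \<le> lead n S \<and> \<not> x ! i}"

definition cand :: "nat \<Rightarrow> bool list set \<Rightarrow> bool list set" where
  "cand n S = {y. length y = n \<and> (\<forall>i<n. i \<le> lead n S \<longrightarrow> y ! i) \<and> (\<forall>x\<in>low n S. card (diffs x y) \<le> 3)}"

text \<open>The choice depends on the candidate set alone, which is unchanged when the apex is
  toggled.\<close>

definition apex :: "bool list set \<Rightarrow> bool list" where
  "apex C = (SOME y. y \<in> C \<and> (\<forall>z\<in>C. card (diffs y z) \<le> 3))"

lemma lead_le: "lead n S \<le> n"
  unfolding lead_def by (rule Least_le) simp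

lemma lead_nth: "x \<in> S \<Longrightarrow> i < lead n S \<Longrightarrow> x ! i"
  unfolding lead_def using not_less_Least by fastforce

lemma lead_witness: "lead n S < n \<Longrightarrow> \<exists>x\<in>S. \<not> x ! lead n S"
  using LeastI[of "\<lambda>p. n \<le> p \<or> (\<exists>x\<in>S. \<not> x ! p)" n] unfolding lead_def by auto

lemma lead_eqI:
  assumes "p \<le> n" "p < n \<Longrightarrow> \<exists>x\<in>S. \<not> x ! p" "\<And>x i. x \<in> S \<Longrightarrow> i < p \<Longrightarrow> x ! i"
  shows "lead n S = p"
  unfolding lead_def
proof (rule Least_equality)
  show "n \<le> p \<or> (\<exists>x\<in>S. \<not> x ! p)" using assms(2) by force
  show "p \<le> q" if "n \<le> q \<or> (\<exists>x\<in>S. \<not> x ! q)" for q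
    using that assms(1,3) by (meson le_trans not_le)
qed

lemma low_iff: "x \<in> low n S \<longleftrightarrow> x \<in> S \<and> lead n S < n \<and> \<not> x ! lead n S"
proof
  assume "x \<in> low n S"
  then obtain i where i: "x \<in> S" "i < n" "i \<le> lead n S" "\<not> x ! i" unfolding low_def by auto
  then have "i = lead n S" using lead_nth[of x S i n] by force
  then show "x \<in> S \<and> lead n S < n \<and> \<not> x ! lead n S" using i by auto
qed (auto simp: low_def)

text \<open>Either some low vertex is within distance 2 of all low vertices, and raising its lead
  coordinate gives the apex, or any two candidates are within distance 3, and every candidate will
  do.\<close>

lemma exists_apex:
  assumes S: "S \<in> VR n" and ne: "cand n S \<noteq> {}"
  shows "\<exists>y\<in>cand n S. \<forall>z\<in>cand n S. card (diffs y z) \<le> 3"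
proof -
  let ?p = "lead n S" and ?T = "low n S"
  have len: "length x = n" if "x \<in> ?T" for x using that S unfolding low_iff VR_iff by auto
  have p_diff: "?p \<in> diffs x y" if "x \<in> ?T" "y \<in> cand n S" for x y
    using that len[OF that(1)] unfolding cand_def low_iff diffs_def by auto
  show ?thesis
  proof (cases "\<exists>z\<in>?T. \<forall>x\<in>?T. card (diffs x z) \<le> 2")
    case True
    then obtain z where z: "z \<in> ?T" "\<And>x. x \<in> ?T \<Longrightarrow> card (diffs x z) \<le> 2" by auto
    define y where "y = z[?p := True]"
    have zl: "length z = n" "?p < n" "\<not> z ! ?p" "z \<in> S" using len z(1) by (auto simp: low_iff)
    have near: "diffs x y \<subseteq> insert ?p (diffs x z)" if "x \<in> ?T" for x
      using zl unfolding y_def diffs_def by (auto simp: nth_list_update split: if_splits)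
    have yc: "y \<in> cand n S"
      unfolding cand_def
    proof (intro CollectI conjI ballI allI impI)
      show "length y = n" using zl by (simp add: y_def)
      show "y ! i" if "i < n" "i \<le> ?p" for i
        using that zl lead_nth[OF zl(4), of i n] by (cases "i = ?p") (auto simp: y_def)
      show "card (diffs x y) \<le> 3" if "x \<in> ?T" for x
      proof -
        have "card (diffs x y) \<le> card (insert ?p (diffs x z))"
          by (rule card_mono) (use near[OF that] in auto)
        also have "\<dots> \<le> Suc (card (diffs x z))" by (rule card_insert_le_m1) auto
        finally show ?thesis using z(2)[OF that] by simp
      qed
    qed
    have "card (diffs y w) \<le> 3" if w: "w \<in> cand n S" for w
    proof -
      \<comment> \<open>Every candidate is True at \<open>?p\<close>, so raising that coordinate of
        \<open>z\<close> only removes a difference.\<close>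
      have "diffs y w \<subseteq> diffs z w"
        using w zl unfolding y_def diffs_def cand_def by (auto simp: nth_list_update split: if_splits)
      then have "card (diffs y w) \<le> card (diffs z w)" by (intro card_mono) auto
      also have "\<dots> \<le> 3" using w z(1) unfolding cand_def by auto
      finally show ?thesis .
    qed
    then show ?thesis using yc by blast
  next
    case False
    have "card (diffs y y') \<le> 3" if y: "y \<in> cand n S" "y' \<in> cand n S" for y y'
    proof (rule ccontr)
      assume far: "\<not> card (diffs y y') \<le> 3"
      have ly: "length y = n" "length y' = n" using y unfolding cand_def by auto
      \<comment> \<open>Both candidates differ from \<open>x\<close> at \<open>?p\<close>, and these
        differences cancel: the distance of \<open>y\<close> and \<open>y'\<close> is at most the
        sum of their distances from \<open>x\<close> minus 2.\<close>
      have three: "card (diffs x y) = 3" if x: "x \<in> ?T" for x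
      proof -
        have c: "card (diffs x y) \<le> 3" "card (diffs x y') \<le> 3" using x y unfolding cand_def by auto
        have "diffs y y' \<subseteq> (diffs x y - {?p}) \<union> (diffs x y' - {?p})"
          using diffs_sym_diff[of y x y'] ly len[OF x] p_diff[OF x y(1)] p_diff[OF x y(2)] by auto
        then have "card (diffs y y') \<le> card ((diffs x y - {?p}) \<union> (diffs x y' - {?p}))"
          by (intro card_mono) auto
        also have "\<dots> \<le> card (diffs x y - {?p}) + card (diffs x y' - {?p})" by (rule card_Un_le)
        finally show ?thesis using far c p_diff[OF x y(1)] p_diff[OF x y(2)] by simp
      qed
      have "?T \<noteq> {}"
      proof
        assume "?T = {}"
        have "\<not> ?p < n"
        proof
          assume p: "?p < n"
          then obtain x where "x \<in> S" "\<not> x ! ?p" using lead_witness by blast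
          then have "x \<in> ?T" using p low_iff by blast
          then show False using \<open>?T = {}\<close> by blast
        qed
        then have "diffs y y' = {}" using y ly unfolding cand_def diffs_def by auto
        then show False using far by simp
      qed
      then obtain x where x: "x \<in> ?T" by blast
      \<comment> \<open>Parity: two vertices at distance 3 from \<open>y\<close> have even distance,
        and it is at most 3. So any low \<open>x\<close> falls under the first case.\<close>
      have "card (diffs x' x) \<le> 2" if x': "x' \<in> ?T" for x'
      proof -
        let ?A = "diffs y x'" and ?B = "diffs y x"
        have "card ?A = 3" "card ?B = 3"
          using three[OF x] three[OF x'] diffs_commute[of x y] diffs_commute[of x' y] len[OF x] len[OF x'] ly
          by simp_all
        then have "card (diffs x' x) + 2 * card (?A \<inter> ?B) = 6"
          using card_sym_diff[of ?A ?B] diffs_sym_diff[of x' y x] ly len[OF x] len[OF x'] by simp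
        moreover have "card (diffs x' x) \<le> 3" using S x x' unfolding VR_iff low_iff by auto
        ultimately show ?thesis by presburger
      qed
      then show False using False x by blast
    qed
    then show ?thesis using ne by blast
  qed
qed

lemma apex:
  assumes "S \<in> VR n" "cand n S \<noteq> {}"
  shows "apex (cand n S) \<in> cand n S" "\<And>z. z \<in> cand n S \<Longrightarrow> card (diffs (apex (cand n S)) z) \<le> 3"
proof -
  have "\<exists>y. y \<in> cand n S \<and> (\<forall>z\<in>cand n S. card (diffs y z) \<le> 3)" using exists_apex[OF assms] by blast
  from someI_ex[OF this] show "apex (cand n S) \<in> cand n S"
    "\<And>z. z \<in> cand n S \<Longrightarrow> card (diffs (apex (cand n S)) z) \<le> 3" unfolding apex_def by blast+
qed

lemma not_low_cand:
  assumes "S \<in> VR n" "x \<in> S" "x \<notin> low n S"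
  shows "x \<in> cand n S"
  using assms unfolding cand_def VR_iff low_def by auto

text \<open>\<open>y\<close> is near the low vertices as a candidate and near the others because
  those are candidates. Being True through the lead coordinate, it influences neither
  \<open>lead\<close> nor \<open>low\<close>.\<close>

lemma flip_cand:
  assumes S: "S \<in> VR n" and y: "y \<in> cand n S" "\<And>z. z \<in> cand n S \<Longrightarrow> card (diffs y z) \<le> 3"
  shows "flip y S \<in> VR n" "lead n (flip y S) = lead n S" "low n (flip y S) = low n S"
    "cand n (flip y S) = cand n S"
proof -
  let ?p = "lead n S"
  have yl: "length y = n" and yt: "\<And>i. i < n \<Longrightarrow> i \<le> ?p \<Longrightarrow> y ! i"
    and yd: "\<And>x. x \<in> low n S \<Longrightarrow> card (diffs x y) \<le> 3"
    using y(1) unfolding cand_def by auto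
  have near: "card (diffs x y) \<le> 3" "card (diffs y x) \<le> 3" if "x \<in> S" for x
  proof -
    have "length x = n" using S that VR_iff by auto
    then have eq: "diffs x y = diffs y x" using yl by (intro diffs_commute) simp
    show c: "card (diffs x y) \<le> 3"
    proof (cases "x \<in> low n S")
      case True
      then show ?thesis by (rule yd)
    next
      case False
      then show ?thesis unfolding eq by (rule y(2)[OF not_low_cand[OF S that]])
    qed
    show "card (diffs y x) \<le> 3" using c unfolding eq .
  qed
  have "insert y S \<in> VR n" using S near yl unfolding VR_iff by auto
  then show "flip y S \<in> VR n" by (rule VR.down_closed) (auto simp: flip_def)
  show lead: "lead n (flip y S) = ?p"
  proof (rule lead_eqI)
    show "?p \<le> n" by (rule lead_le)
    show "\<exists>x\<in>flip y S. \<not> x ! ?p" if p: "?p < n"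
    proof -
      obtain x where "x \<in> S" "\<not> x ! ?p" using lead_witness[OF p] by blast
      moreover have "x \<noteq> y" using yt p calculation by blast
      ultimately show ?thesis by (auto simp: flip_def)
    qed
    show "x ! i" if "x \<in> flip y S" "i < ?p" for x i
      using that yt[of i] lead_nth[of x S i n] lead_le[of n S] by (auto simp: flip_def split: if_splits)
  qed
  show low: "low n (flip y S) = low n S"
  proof -
    have "x \<in> low n (flip y S) \<longleftrightarrow> x \<in> low n S" for x
      unfolding low_iff lead using yt by (auto simp: flip_def)
    then show ?thesis by blast
  qed
  show "cand n (flip y S) = cand n S" unfolding cand_def lead low by simp
qed

text \<open>The simplices without candidates, described inside the face of vertices True before
  \<open>p\<close> and False at \<open>p\<close>: no ball of radius 2 centered in that face contains
  them.\<close>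

definition residual :: "nat \<Rightarrow> nat \<Rightarrow> bool list set \<Rightarrow> bool" where
  "residual n p S \<longleftrightarrow> S \<in> VR n \<and> S \<noteq> {} \<and> p < n \<and> (\<forall>x\<in>S. \<not> x ! p \<and> (\<forall>i<p. x ! i)) \<and>
    (\<forall>u. length u = n \<longrightarrow> (\<forall>i<p. u ! i) \<longrightarrow> \<not> u ! p \<longrightarrow> (\<exists>x\<in>S. 3 \<le> card (diffs x u)))"

text \<open>A center \<open>u\<close> of a ball of radius 2, with coordinate \<open>?p\<close>
  raised to True, would be within distance 3 of \<open>S\<close> and hence a candidate.\<close>

lemma residualI:
  assumes S: "S \<in> VR n" and c: "cand n S = {}"
  shows "residual n (lead n S) S"
proof -
  let ?p = "lead n S"
  have low: "x \<in> low n S" if "x \<in> S" for x using not_low_cand[OF S that] c by auto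
  have "low n S \<noteq> {}"
  proof
    assume "low n S = {}"
    then have "replicate n True \<in> cand n S" unfolding cand_def by auto
    then show False using c by simp
  qed
  then have ne: "S \<noteq> {}" and p: "?p < n" using low_iff by auto
  have "\<exists>x\<in>S. 3 \<le> card (diffs x u)" if u: "length u = n" "\<And>i. i < ?p \<Longrightarrow> u ! i" "\<not> u ! ?p" for u
  proof -
    define y where "y = u[?p := True]"
    have "y ! i" if "i < n" "i \<le> ?p" for i using that u p by (cases "i = ?p") (auto simp: y_def)
    moreover have "length y = n" using u by (simp add: y_def)
    moreover have "y \<notin> cand n S" using c by simp
    ultimately obtain x where x: "x \<in> low n S" "\<not> card (diffs x y) \<le> 3" unfolding cand_def by auto
    have xp: "\<not> x ! ?p" "x \<in> S" using x low_iff by auto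
    then have "diffs x y \<subseteq> insert ?p (diffs x u)"
      unfolding y_def diffs_def using u p by (auto simp: nth_list_update split: if_splits)
    then have "card (diffs x y) \<le> card (insert ?p (diffs x u))" by (intro card_mono) auto
    also have "\<dots> \<le> Suc (card (diffs x u))" by (rule card_insert_le_m1) auto
    finally show ?thesis using x(2) xp(2) by (intro bexI[of _ x]) auto
  qed
  moreover have "\<not> x ! ?p" "\<forall>i<?p. x ! i" if "x \<in> S" for x
    using low[OF that] lead_nth[OF that, of _ n] low_iff by auto
  ultimately show ?thesis unfolding residual_def using S ne p by auto
qed

text \<open>Conversely, lowering coordinate \<open>p\<close> of a candidate decreases its distance
  from every vertex of \<open>S\<close> by one and gives the center of a ball of radius 2.\<close>

lemma residualD:
  assumes r: "residual n p S"
  shows "lead n S = p" "low n S = S" "cand n S = {}"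
proof -
  have S: "S \<in> VR n" and ne: "S \<noteq> {}" and p: "p < n" and x: "\<And>x. x \<in> S \<Longrightarrow> \<not> x ! p"
    "\<And>x i. x \<in> S \<Longrightarrow> i < p \<Longrightarrow> x ! i" using r unfolding residual_def by auto
  show lead: "lead n S = p" by (rule lead_eqI) (use ne p x in auto)
  show low: "low n S = S" using x(1) p by (auto simp: low_iff lead)
  have False if y: "y \<in> cand n S" for y
  proof -
    define u where "u = y[p := False]"
    have ly: "length y = n" and yp: "y ! p" and yi: "\<And>i. i < p \<Longrightarrow> y ! i"
      using y p unfolding cand_def lead by auto
    have "length u = n" "\<forall>i<p. u ! i" "\<not> u ! p" using ly yi p by (auto simp: u_def)
    then obtain w where w: "w \<in> S" "3 \<le> card (diffs w u)" using r unfolding residual_def by blast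
    have lw: "length w = n" using w S VR_iff by auto
    have "diffs w y = insert p (diffs w u)"
      unfolding u_def diffs_def using x(1)[OF w(1)] ly yp lw p by (auto simp: nth_list_update)
    moreover have "p \<notin> diffs w u" using x(1)[OF w(1)] ly p by (auto simp: u_def diffs_def)
    ultimately have "4 \<le> card (diffs w y)" using w(2) by simp
    moreover have "card (diffs w y) \<le> 3" using y w(1) low unfolding cand_def by auto
    ultimately show False by simp
  qed
  then show "cand n S = {}" by blast
qed

section \<open>Simplices without a center\<close>

definition reflect :: "nat set \<Rightarrow> bool list \<Rightarrow> bool list" where
  "reflect E a = map (\<lambda>i. a ! i \<noteq> (i \<in> E)) [0..<length a]"

lemma length_reflect [simp]: "length (reflect E a) = length a"
  by (simp add: reflect_def)

lemma nth_reflect [simp]: "i < length a \<Longrightarrow> reflect E a ! i \<longleftrightarrow> a ! i \<noteq> (i \<in> E)"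
  by (simp add: reflect_def)

lemma diffs_reflect: "E \<subseteq> {..<length a} \<Longrightarrow> diffs a (reflect E a) = E"
  by (auto simp: diffs_def)

text \<open>The directions of the smallest face of the cube that contains \<open>S\<close>.\<close>

definition active :: "nat \<Rightarrow> bool list set \<Rightarrow> nat set" where
  "active n S = {i. i < n \<and> (\<exists>x\<in>S. \<exists>y\<in>S. x ! i \<noteq> y ! i)}"

lemma finite_active [simp]: "finite (active n S)"
  by (simp add: active_def)

text \<open>Both \<open>b\<close> and \<open>b'\<close> are the union of the two singletons.\<close>

lemma middle_unique:
  assumes "card a = 1" "card a' = 1" "a \<noteq> a'" "card b = 2" "card b' = 2"
    "a \<subseteq> b" "a' \<subseteq> b" "a \<subseteq> b'" "a' \<subseteq> b'"
  shows "b = b'"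
proof -
  obtain x y where xy: "a = {x}" "a' = {y}" using assms(1,2) by (auto simp: card_1_singleton_iff)
  have "{x, y} = c" if "card c = 2" "a \<subseteq> c" "a' \<subseteq> c" for c
  proof (rule card_subset_eq)
    show "finite c" using that(1) card.infinite by fastforce
    show "card {x, y} = card c" using that xy assms(3) by auto
  qed (use that xy in auto)
  then show ?thesis using assms by metis
qed

text \<open>The proper nonempty subsets of a 3-element set form a hexagon under inclusion: two vertices that
  are not adjacent have at most one common neighbor.\<close>

lemma hexagon:
  assumes size: "card a \<in> {1, 2}" "card a' \<in> {1, 2}" "card b \<in> {1, 2}" "card b' \<in> {1, 2}"
    and far: "2 \<le> card (sym_diff a a')" "2 \<le> card (sym_diff b b')"
    and near: "card (sym_diff a b) \<le> 1" "card (sym_diff a b') \<le> 1"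
      "card (sym_diff a' b) \<le> 1" "card (sym_diff a' b') \<le> 1"
  shows False
proof -
  have fin: "finite a" "finite a'" "finite b" "finite b'"
    using size by (auto intro: card_ge_0_finite)
  have ne: "a \<noteq> a'" "b \<noteq> b'" using far by auto
  \<comment> \<open>If, say, \<open>a = b\<close>, then \<open>a'\<close> would be near
    \<open>a\<close>.\<close>
  have neq: "a \<noteq> b" "a \<noteq> b'" "a' \<noteq> b" "a' \<noteq> b'"
    using near far(1) by (metis Un_commute not_less_eq_eq numeral_2_eq_2 One_nat_def)+
  \<comment> \<open>Distinct near sets differ in one element, so by parity their sizes are 1 and 2
    and the singleton lies in the pair.\<close>
  have step: "card c \<noteq> card d \<and> card (c \<inter> d) = 1"
    if "card c \<in> {1, 2}" "card d \<in> {1, 2}" "card (sym_diff c d) \<le> 1" "c \<noteq> d" "finite c" "finite d"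
    for c d :: "'a set"
  proof -
    have "sym_diff c d \<noteq> {}" using that(4) by blast
    then have "card (sym_diff c d) = 1" using that(3,5,6) by (metis One_nat_def card_0_eq finite_Diff finite_UnI le_SucE le_zero_eq)
    then have "1 + 2 * card (c \<inter> d) = card c + card d" using card_sym_diff[OF that(5,6)] by simp
    moreover have "card c = 1 \<or> card c = 2" "card d = 1 \<or> card d = 2" using that(1,2) by blast+
    ultimately show ?thesis by presburger
  qed
  note s = step[OF size(1,3) near(1) neq(1) fin(1,3)] step[OF size(1,4) near(2) neq(2) fin(1,4)]
    step[OF size(2,3) near(3) neq(3) fin(2,3)] step[OF size(2,4) near(4) neq(4) fin(2,4)]
  have sub: "c \<subseteq> d" if "card (c \<inter> d) = 1" "card c = 1" "finite c" for c d :: "'a set"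
    using card_subset_eq[of c "c \<inter> d"] that by auto
  show False
  proof (cases "card a = 1")
    case True
    then have c: "card b = 2" "card b' = 2" "card a' = 1" using s size by auto
    have "b = b'"
      by (rule middle_unique[OF True c(3) ne(1) c(1,2)]; rule sub; (use s True c fin in simp))
    then show False using ne by simp
  next
    case False
    then have c: "card b = 1" "card b' = 1" "card a' = 2" "card a = 2" using s size by auto
    have "a = a'"
      by (rule middle_unique[OF c(1,2) ne(2) c(4,3)]; rule sub; (use s c fin in \<open>simp add: Int_commute\<close>))
    then show False using ne by simp
  qed
qed

text \<open>Each vertex \<open>t\<close> is encoded by its difference set \<open>?A t\<close> from a
  fixed \<open>a\<close> in \<open>S\<close>; \<open>D\<close> spans the 3-cube with antipodes
  \<open>a\<close> and \<open>b\<close>. All vertices leave it in at most one common direction,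
  which leaves 3 or 4 active directions.\<close>

lemma residual_active:
  assumes r: "residual n p S"
  shows "card (active n S) = 3 \<and> card S = 8 \<or> card (active n S) = 4"
proof -
  have len: "length t = n" and pre: "\<not> t ! p" "\<And>i. i < p \<Longrightarrow> t ! i" if "t \<in> S" for t
    using r that unfolding residual_def VR_iff by auto
  have d3: "card (diffs t u) \<le> 3" if "t \<in> S" "u \<in> S" for t u
    using r that unfolding residual_def VR_iff by auto
  have p: "p < n" using r unfolding residual_def by auto
  obtain a where a: "a \<in> S" using r unfolding residual_def by auto
  let ?A = "\<lambda>t. diffs a t"
  have dd: "diffs t u = sym_diff (?A t) (?A u)" if "length t = n" "length u = n" for t u
    using diffs_sym_diff[of t a u] that len[OF a] by simp
  have sub_n: "?A t \<subseteq> {..<n}" for t using len[OF a] by (auto simp: diffs_def)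
  have gt: "p < i" if "i \<in> ?A t" "t \<in> S" for i t
  proof (rule ccontr)
    assume "\<not> p < i"
    then show False using that pre[OF a] pre[OF that(2)] unfolding diffs_def by (cases "i = p") auto
  qed
  have center: "\<exists>t\<in>S. 3 \<le> card (sym_diff (?A t) E)" if E: "E \<subseteq> {p<..<n}" for E
  proof -
    let ?u = "reflect E a"
    have "length ?u = n" "\<forall>i<p. ?u ! i" "\<not> ?u ! p" using len[OF a] pre[OF a] p E by auto
    then obtain t where t: "t \<in> S" "3 \<le> card (diffs t ?u)" using r unfolding residual_def by blast
    moreover have "E \<subseteq> {..<length a}" using E len[OF a] by auto
    then have "?A ?u = E" by (rule diffs_reflect)
    then have "diffs t ?u = sym_diff (?A t) E" using dd[of t ?u] len[OF t(1)] len[OF a] by simp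
    ultimately show ?thesis by auto
  qed
  obtain b where b: "b \<in> S" "3 \<le> card (?A b)" using center[of "{}"] by auto
  define D where "D = ?A b"
  have D: "card D = 3" "finite D" using d3[OF a b(1)] b(2) by (auto simp: D_def)
  have split: "card (sym_diff (?A t) (?A u)) = card (sym_diff (?A t \<inter> D) (?A u \<inter> D)) + card (sym_diff (?A t - D) (?A u - D))" for t u
  proof -
    have "sym_diff (?A t) (?A u) = sym_diff (?A t \<inter> D) (?A u \<inter> D) \<union> sym_diff (?A t - D) (?A u - D)" by blast
    then show ?thesis by (simp only:) (intro card_Un_disjoint; auto)
  qed
  \<comment> \<open>The distances of \<open>t\<close> from \<open>a\<close> and \<open>b\<close> sum
    to 3 plus twice the number of directions outside \<open>D\<close>. Both are at most 3, so there
    is at most one such direction, and then \<open>t\<close> projects to neither \<open>a\<close>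
    nor \<open>b\<close>.\<close>
  have out: "card (?A t - D) \<le> 1" "?A t - D \<noteq> {} \<Longrightarrow> card (?A t \<inter> D) \<in> {1, 2}" if t: "t \<in> S" for t
  proof -
    have 1: "card (?A t) = card (?A t \<inter> D) + card (?A t - D)" by (rule card_Int_Diff) simp
    have 2: "card (sym_diff (?A t) D) + 2 * card (?A t \<inter> D) = card (?A t) + 3"
      using card_sym_diff[of "?A t" D] D by simp
    have 3: "card (sym_diff (?A t) D) \<le> 3" using d3[OF t b(1)] dd[OF len[OF t] len[OF b(1)]] by (simp add: D_def)
    have 4: "card (?A t) \<le> 3" using d3[OF a t] .
    show "card (?A t - D) \<le> 1" using 1 2 3 4 by linarith
    assume "?A t - D \<noteq> {}"
    then have "card (?A t - D) \<noteq> 0" by auto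
    then show "card (?A t \<inter> D) \<in> {1, 2}" using 1 2 3 4 by (auto, linarith+)
  qed
  have out_eq: "?A t - D = {x}" if "t \<in> S" "x \<in> ?A t - D" for t x
    using out(1)[OF that(1)] that(2) by (metis card_1_singletonE card_0_eq empty_iff finite_Diff finite_diffs le_SucE le_zero_eq One_nat_def singletonD)
  have two: "card (sym_diff (?A t - D) (?A s - D)) = 2"
    if "t \<in> S" "s \<in> S" "x \<in> ?A t - D" "y \<in> ?A s - D" "x \<noteq> y" for t s x y
    using out_eq[OF that(1,3)] out_eq[OF that(2,4)] that(5) by auto
  \<comment> \<open>Different outer directions use up 2 of the allowed distance 3.\<close>
  have cross: "card (sym_diff (?A t \<inter> D) (?A s \<inter> D)) \<le> 1"
    if "t \<in> S" "s \<in> S" "x \<in> ?A t - D" "y \<in> ?A s - D" "x \<noteq> y" for t s x y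
    using two[OF that] split[of t s] d3[OF that(1,2)] dd[OF len[OF that(1)] len[OF that(2)]] by simp
  \<comment> \<open>Take the projection of \<open>s\<close> to the 3-cube as center. A witness at
    distance 3 or more that stays in the 3-cube would be too far from \<open>s\<close>, and one
    leaving in another direction contradicts \<open>cross\<close>.\<close>
  have star: "\<exists>t\<in>S. x \<in> ?A t - D \<and> 2 \<le> card (sym_diff (?A s \<inter> D) (?A t \<inter> D))"
    if s: "s \<in> S" "x \<in> ?A s - D" for s x
  proof -
    have "?A s \<inter> D \<subseteq> {p<..<n}" using gt[OF _ s(1)] sub_n[of s] by auto
    from center[OF this] obtain t where t: "t \<in> S" "3 \<le> card (sym_diff (?A t) (?A s \<inter> D))" by blast
    have "sym_diff (?A t) (?A s \<inter> D) = sym_diff (?A s \<inter> D) (?A t \<inter> D) \<union> (?A t - D)" by blast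
    then have c: "3 \<le> card (sym_diff (?A s \<inter> D) (?A t \<inter> D)) + card (?A t - D)"
      using t(2) card_Un_le[of "sym_diff (?A s \<inter> D) (?A t \<inter> D)" "?A t - D"] by simp
    have e: "card (sym_diff (?A s \<inter> D) (?A t \<inter> D)) + card (sym_diff (?A s - D) (?A t - D)) \<le> 3"
      using split[of s t] d3[OF s(1) t(1)] dd[OF len[OF s(1)] len[OF t(1)]] by simp
    have "?A t - D \<noteq> {}"
    proof
      assume empty: "?A t - D = {}"
      show False using c e unfolding empty out_eq[OF s] by simp
    qed
    then obtain z where z: "z \<in> ?A t - D" by blast
    have "z = x"
    proof (rule ccontr)
      assume "z \<noteq> x"
      then show False using cross[OF s(1) t(1) s(2) z] c out(1)[OF t(1)] by simp
    qed
    then show ?thesis using t(1) z c out(1)[OF t(1)] by (intro bexI[of _ t]) auto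
  qed
  \<comment> \<open>Two outer directions would give, by \<open>star\<close>, a nonadjacent pair of
    hexagon vertices each, and by \<open>cross\<close> every vertex of one pair would be near every
    vertex of the other.\<close>
  have "\<exists>x. \<forall>t\<in>S. ?A t \<subseteq> insert x D"
  proof (rule ccontr)
    assume "\<not> ?thesis"
    then have neg: "\<exists>t\<in>S. \<exists>y. y \<in> ?A t - D \<and> y \<noteq> x" for x by blast
    obtain t x where t: "t \<in> S" "x \<in> ?A t - D" using neg by blast
    obtain s y where s: "s \<in> S" "y \<in> ?A s - D" "x \<noteq> y" using neg[of x] by blast
    obtain t' where t': "t' \<in> S" "x \<in> ?A t' - D" "2 \<le> card (sym_diff (?A t \<inter> D) (?A t' \<inter> D))"
      using star[OF t] by blast
    obtain s' where s': "s' \<in> S" "y \<in> ?A s' - D" "2 \<le> card (sym_diff (?A s \<inter> D) (?A s' \<inter> D))"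
      using star[OF s(1,2)] by blast
    have size: "card (?A u \<inter> D) \<in> {1, 2}" if "u \<in> S" "w \<in> ?A u - D" for u w
      using out(2)[OF that(1)] that(2) by blast
    show False
      by (rule hexagon[OF size[OF t] size[OF t'(1,2)] size[OF s(1,2)] size[OF s'(1,2)] t'(3) s'(3)
            cross[OF t(1) s(1) t(2) s(2,3)] cross[OF t(1) s'(1) t(2) s'(2) s(3)]
            cross[OF t'(1) s(1) t'(2) s(2,3)] cross[OF t'(1) s'(1) t'(2) s'(2) s(3)]])
  qed
  then obtain x where x: "\<And>t. t \<in> S \<Longrightarrow> ?A t \<subseteq> insert x D" by blast
  have A_active: "?A t \<subseteq> active n S" if "t \<in> S" for t
    using a that len[OF a] unfolding active_def diffs_def by auto
  have "active n S \<subseteq> insert x D"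
  proof
    fix i assume "i \<in> active n S"
    then obtain u v where uv: "u \<in> S" "v \<in> S" "u ! i \<noteq> v ! i" "i < n" unfolding active_def by auto
    then have "i \<in> ?A u \<union> ?A v" using len[OF a] unfolding diffs_def by auto
    then show "i \<in> insert x D" using x[OF uv(1)] x[OF uv(2)] by blast
  qed
  then have "card (active n S) \<le> card (insert x D)" using D by (intro card_mono) auto
  also have "\<dots> \<le> 4" using card_insert_le_m1[of 4 D x] D by simp
  finally have le: "card (active n S) \<le> 4" .
  have D_sub: "D \<subseteq> active n S" using A_active[OF b(1)] by (simp add: D_def)
  then have ge: "3 \<le> card (active n S)" using D card_mono[of "active n S" D] by simp
  have "card S = 8" if "card (active n S) = 3"
  proof -
    have act: "active n S = D" using card_subset_eq[of "active n S" D] D_sub D that by simp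
    have "bij_betw ?A S (Pow D)"
      unfolding bij_betw_def
    proof
      show "inj_on ?A S"
      proof (rule inj_onI)
        fix t u assume tu: "t \<in> S" "u \<in> S" "?A t = ?A u"
        then have "diffs t u = {}" using dd[of t u] len by auto
        then show "t = u" using diffs_eq_empty_iff[of t u] len[OF tu(1)] len[OF tu(2)] by simp
      qed
      show "?A ` S = Pow D"
      proof
        show "?A ` S \<subseteq> Pow D" using A_active act by blast
        show "Pow D \<subseteq> ?A ` S"
        proof
          fix E assume "E \<in> Pow D"
          then have E: "E \<subseteq> D" by blast
          \<comment> \<open>In a 3-cube the ball of radius 2 around \<open>D - E\<close> misses only
            the antipode \<open>E\<close>, so \<open>E\<close> must occur in
            \<open>S\<close>.\<close>
          have "D - E \<subseteq> {p<..<n}" using gt[OF _ b(1)] sub_n[of b] by (auto simp: D_def)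
          from center[OF this] obtain t where t: "t \<in> S" "3 \<le> card (sym_diff (?A t) (D - E))" by blast
          have tD: "?A t \<subseteq> D" using A_active[OF t(1)] act by simp
          then have "sym_diff (?A t) (D - E) \<subseteq> D" by blast
          then have "sym_diff (?A t) (D - E) = D" using card_seteq[of D] D t(2) by simp
          then have "?A t = E" using tD E by blast
          then show "E \<in> ?A ` S" using t(1) by blast
        qed
      qed
    qed
    then have "card S = card (Pow D)" by (rule bij_betw_same_card)
    then show ?thesis using D by (simp add: card_Pow)
  qed
  then show ?thesis using le ge by linarith
qed

lemma active_mono: "S \<subseteq> T \<Longrightarrow> active n S \<subseteq> active n T"
  unfolding active_def by blast

section \<open>Binary labels on 4-dimensional faces\<close>

lemma bits_check: "\<forall>k\<in>set [0..<16]. \<forall>l\<in>set [0..<16].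
  (l \<in> set (far k) \<longleftrightarrow> 3 \<le> length (filter (\<lambda>j. bit k j \<noteq> bit l j) [0..<4])) \<and>
  (l = 15 - k \<longleftrightarrow> 4 \<le> length (filter (\<lambda>j. bit k j \<noteq> bit l j) [0..<4])) \<and>
  (l = k \<longleftrightarrow> length (filter (\<lambda>j. bit k j \<noteq> bit l j) [0..<4]) = 0)"
  by code_simp

lemma card_bits: "card {j. j < 4 \<and> P j} = length (filter P [0..<4])"
  using distinct_length_filter[of "[0..<4]" P] by (simp add: Collect_conj_eq Int_commute lessThan_def atLeast0LessThan)

lemma bits:
  assumes "k < 16" "l < (16::nat)"
  shows "l \<in> set (far k) \<longleftrightarrow> 3 \<le> card {j. j < 4 \<and> bit k j \<noteq> bit l j}"
    "l = 15 - k \<longleftrightarrow> 4 \<le> card {j. j < 4 \<and> bit k j \<noteq> bit l j}"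
    "l = k \<longleftrightarrow> card {j. j < 4 \<and> bit k j \<noteq> bit l j} = 0"
proof -
  have "k \<in> set [0..<16]" "l \<in> set [0..<16]" using assms by auto
  from bits_check[THEN bspec, OF this(1), THEN bspec, OF this(2)]
  show "l \<in> set (far k) \<longleftrightarrow> 3 \<le> card {j. j < 4 \<and> bit k j \<noteq> bit l j}"
    "l = 15 - k \<longleftrightarrow> 4 \<le> card {j. j < 4 \<and> bit k j \<noteq> bit l j}"
    "l = k \<longleftrightarrow> card {j. j < 4 \<and> bit k j \<noteq> bit l j} = 0"
    unfolding card_bits by blast+
qed

text \<open>The witness is \<open>k\<close> with bit \<open>j\<close> flipped.\<close>

lemma far_singled_out:
  assumes "k < 16" "j < 4"
  shows "\<exists>u<16. \<forall>x\<in>set (far u). bit x j \<noteq> bit k j \<longrightarrow> x = 15 - k"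
proof -
  have "\<forall>k\<in>set [0..<16]. \<forall>j\<in>set [0..<4]. \<exists>u\<in>set [0..<16]. \<forall>x\<in>set (far u). bit x j \<noteq> bit k j \<longrightarrow> x = 15 - k"
    by code_simp
  moreover have "k \<in> set [0..<16]" "j \<in> set [0..<4]" using assms by auto
  ultimately obtain u where "u \<in> set [0..<16]" "\<forall>x\<in>set (far u). bit x j \<noteq> bit k j \<longrightarrow> x = 15 - k"
    by blast
  then show ?thesis by (intro exI[of _ u]) simp
qed

lemma bits_exist: "\<exists>k<16::nat. \<forall>j<4. bit k j \<longleftrightarrow> f j"
proof -
  have "\<forall>a\<in>{False, True}. \<forall>b\<in>{False, True}. \<forall>c\<in>{False, True}. \<forall>d\<in>{False, True}.
    \<exists>k\<in>set [0..<16::nat]. (bit k 0 \<longleftrightarrow> a) \<and> (bit k 1 \<longleftrightarrow> b) \<and> (bit k 2 \<longleftrightarrow> c) \<and> (bit k 3 \<longleftrightarrow> d)"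
    by code_simp
  then have "\<exists>k\<in>set [0..<16::nat]. (bit k 0 \<longleftrightarrow> f 0) \<and> (bit k 1 \<longleftrightarrow> f 1) \<and> (bit k 2 \<longleftrightarrow> f 2) \<and> (bit k 3 \<longleftrightarrow> f 3)"
    by (cases "f 0"; cases "f 1"; cases "f 2"; cases "f 3"; simp only: ball_simps simp_thms)
  then obtain k :: nat where "k \<in> set [0..<16]" "bit k 0 \<longleftrightarrow> f 0" "bit k 1 \<longleftrightarrow> f 1" "bit k 2 \<longleftrightarrow> f 2" "bit k 3 \<longleftrightarrow> f 3"
    by blast
  moreover from this(1) have "k < 16" by simp
  moreover have "j = 0 \<or> j = 1 \<or> j = 2 \<or> j = 3" if "j < 4" for j :: nat using that by linarith
  ultimately show ?thesis by (intro exI[of _ k]) blast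
qed

definition rank :: "nat set \<Rightarrow> nat \<Rightarrow> nat" where
  "rank W i = card {j\<in>W. j < i}"

text \<open>\<open>rank W\<close> is strictly increasing on \<open>W\<close>, hence injective, and
  the sizes agree.\<close>

lemma bij_betw_rank:
  assumes "finite W"
  shows "bij_betw (rank W) W {..<card W}"
proof -
  have less: "rank W i < rank W j" if "i \<in> W" "i < j" for i j
    unfolding rank_def using that assms by (intro psubset_card_mono) auto
  have inj: "inj_on (rank W) W"
    by (rule inj_onI) (metis less less_irrefl linorder_neqE_nat)
  have "rank W i < card W" if "i \<in> W" for i
    unfolding rank_def using that assms by (intro psubset_card_mono) auto
  then have "rank W ` W \<subseteq> {..<card W}" by auto
  moreover have "card (rank W ` W) = card {..<card W}" using card_image[OF inj] by simp
  ultimately have "rank W ` W = {..<card W}" by (intro card_subset_eq) auto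
  then show ?thesis using inj by (simp add: bij_betw_def)
qed

text \<open>The vertex with binary label \<open>k\<close> on the face with free directions
  \<open>W\<close> and the other coordinates fixed by \<open>f\<close>.\<close>

definition cube_point :: "nat \<Rightarrow> nat set \<Rightarrow> (nat \<Rightarrow> bool) \<Rightarrow> nat \<Rightarrow> bool list" where
  "cube_point n W f k = map (\<lambda>i. if i \<in> W then bit k (rank W i) else f i) [0..<n]"

locale four_cube =
  fixes n p :: nat and W :: "nat set" and f :: "nat \<Rightarrow> bool"
  assumes W: "W \<subseteq> {p<..<n}" "card W = 4"
    and p: "p < n" and f: "\<And>i. i < p \<Longrightarrow> f i" "\<not> f p"
begin

abbreviation point :: "nat \<Rightarrow> bool list" where
  "point \<equiv> cube_point n W f"

lemma finite_W: "finite W"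
  using W(2) card.infinite by fastforce

lemma rank: "bij_betw (rank W) W {..<4}"
  using bij_betw_rank[OF finite_W] W(2) by simp

lemma rank_less: "i \<in> W \<Longrightarrow> rank W i < 4"
  using rank by (auto simp: bij_betw_def)

lemma length_point [simp]: "length (point k) = n"
  by (simp add: cube_point_def)

lemma nth_point: "i < n \<Longrightarrow> point k ! i \<longleftrightarrow> (if i \<in> W then bit k (rank W i) else f i)"
  by (simp add: cube_point_def)

lemma card_rank: "card {i\<in>W. P (rank W i)} = card {j. j < 4 \<and> P j}"
proof (rule bij_betw_same_card)
  show "bij_betw (rank W) {i\<in>W. P (rank W i)} {j. j < 4 \<and> P j}"
    by (rule bij_betw_subset[OF rank, of _ _]) (use rank in \<open>auto simp: bij_betw_def image_iff\<close>)
qed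

lemma card_diffs_point: "card (diffs (point k) (point l)) = card {j. j < 4 \<and> bit k j \<noteq> bit l j}"
proof -
  have "diffs (point k) (point l) = {i\<in>W. bit k (rank W i) \<noteq> bit l (rank W i)}"
    using W(1) by (auto simp: diffs_def nth_point split: if_splits)
  then show ?thesis using card_rank[of "\<lambda>j. bit k j \<noteq> bit l j"] by simp
qed

lemma inj_point: "k < 16 \<Longrightarrow> l < 16 \<Longrightarrow> point k = point l \<Longrightarrow> k = l"
  using card_diffs_point[of k l] bits(3)[of k l] by simp

text \<open>\<open>k\<close> labels the projection of \<open>u\<close> to the face.\<close>

lemma exists_index: "\<exists>k<16::nat. \<forall>i\<in>W. bit k (rank W i) \<longleftrightarrow> u ! i"
proof -
  obtain k :: nat where k: "k < 16" "\<forall>j<4. bit k j \<longleftrightarrow> u ! inv_into W (rank W) j"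
    using bits_exist[of "\<lambda>j. u ! inv_into W (rank W) j"] by blast
  have "bit k (rank W i) \<longleftrightarrow> u ! i" if "i \<in> W" for i
  proof -
    have "inv_into W (rank W) (rank W i) = i" using that rank by (simp add: bij_betw_def)
    then show ?thesis using k(2) rank_less[OF that] by simp
  qed
  then show ?thesis using k(1) by blast
qed

lemma active_point: "active n (point ` M) \<subseteq> W"
  unfolding active_def by (auto simp: nth_point split: if_splits)

text \<open>A center \<open>u\<close> off the face is at least as far from the points of the face as
  its projection is, so the far vertex for the projection also serves \<open>u\<close>.\<close>

lemma residual_point:
  assumes M: "wide M"
  shows "residual n p (point ` M)"
proof -
  have less: "k < 16" if "k \<in> M" for k using M that unfolding wide_def by auto
  have "card (diffs (point k) (point l)) \<le> 3" if "k \<in> M" "l \<in> M" for k l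
  proof -
    have "l \<noteq> 15 - k" using M that unfolding wide_def by auto
    then show ?thesis using bits(2)[of k l] less that card_diffs_point by simp
  qed
  then have K: "point ` M \<in> VR n" unfolding VR_iff by auto
  have "\<exists>x\<in>M. x \<in> set (far 0)" using M unfolding wide_def by auto
  then have ne: "point ` M \<noteq> {}" by auto
  have pre: "\<not> point k ! p" "\<forall>i<p. point k ! i" for k
    using W(1) p f by (auto simp: nth_point)
  have "\<exists>x\<in>point ` M. 3 \<le> card (diffs x u)" if u: "length u = n" for u
  proof -
    obtain l :: nat where l: "l < 16" "\<forall>i\<in>W. bit l (rank W i) \<longleftrightarrow> u ! i" using exists_index by blast
    obtain k where k: "k \<in> M" "k \<in> set (far l)" using M l(1) unfolding wide_def by blast
    have "3 \<le> card {j. j < 4 \<and> bit l j \<noteq> bit k j}" using bits(1)[OF l(1) less[OF k(1)]] k(2) by simp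
    also have "\<dots> = card {i\<in>W. bit l (rank W i) \<noteq> bit k (rank W i)}"
      using card_rank[of "\<lambda>j. bit l j \<noteq> bit k j"] by simp
    also have "\<dots> \<le> card (diffs (point k) u)"
      by (rule card_mono) (use l(2) W(1) in \<open>auto simp: diffs_def nth_point\<close>)
    finally show ?thesis using k(1) by blast
  qed
  then show ?thesis unfolding residual_def using K ne p pre by blast
qed

text \<open>Only removing \<open>w\<close> could make a direction constant. Then every other vertex
  of \<open>M\<close> would differ from \<open>w\<close> in that bit, and
  \<open>far_singled_out\<close> together with wideness after the flip would force the antipode of
  \<open>w\<close> into \<open>M\<close>.\<close>

lemma active_point_flip:
  assumes M: "wide M" "wide (flip w M)" "w < 16" and act: "active n (point ` M) = W"
  shows "active n (point ` flip w M) = W"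
proof
  show "active n (point ` flip w M) \<subseteq> W" by (rule active_point)
  show "W \<subseteq> active n (point ` flip w M)"
  proof (cases "w \<in> M")
    case False
    then have "point ` M \<subseteq> point ` flip w M" by (auto simp: flip_def)
    then have "active n (point ` M) \<subseteq> active n (point ` flip w M)" by (rule active_mono)
    then show ?thesis using act by simp
  next
    case True
    show ?thesis
    proof
      fix i assume i: "i \<in> W"
      then have "i < n" using W(1) by auto
      show "i \<in> active n (point ` flip w M)"
      proof (rule ccontr)
        assume no: "i \<notin> active n (point ` flip w M)"
        have const: "x ! i = y ! i" if "x \<in> point ` flip w M" "y \<in> point ` flip w M" for x y
          using no \<open>i < n\<close> that unfolding active_def by blast
        have eq: "bit k (rank W i) = bit l (rank W i)" if "k \<in> M - {w}" "l \<in> M - {w}" for k l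
        proof -
          have "k \<in> flip w M" "l \<in> flip w M" using that True by (simp_all add: flip_def)
          then have "point k ! i = point l ! i" by (intro const imageI)
          then show ?thesis using i \<open>i < n\<close> by (simp add: nth_point)
        qed
        have "i \<in> active n (point ` M)" using i act by simp
        then obtain k l where kl: "k \<in> M" "l \<in> M" "point k ! i \<noteq> point l ! i"
          unfolding active_def by blast
        then have kl: "k \<in> M" "l \<in> M" "bit k (rank W i) \<noteq> bit l (rank W i)"
          using i \<open>i < n\<close> by (simp_all add: nth_point)
        have neq: "bit m (rank W i) \<noteq> bit w (rank W i)" if "m \<in> M - {w}" for m
          using eq[OF that, of k] eq[OF that, of l] kl by (cases "k = w"; cases "l = w") auto
        obtain u where u: "u < 16" "\<forall>x\<in>set (far u). bit x (rank W i) \<noteq> bit w (rank W i) \<longrightarrow> x = 15 - w"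
          using far_singled_out[OF M(3) rank_less[OF i]] by blast
        obtain x where "x \<in> flip w M" "x \<in> set (far u)" using M(2) u(1) unfolding wide_def by blast
        then have "x \<in> M - {w}" "x \<in> set (far u)" using True by (auto simp: flip_def)
        then have "15 - w \<in> M" using u(2) neq by blast
        then show False using M(1) True unfolding wide_def by blast
      qed
    qed
  qed
qed

end

text \<open>At inactive coordinates all vertices of \<open>S\<close> agree, so the existential reads
  off the common value.\<close>

definition embed :: "nat \<Rightarrow> bool list set \<Rightarrow> nat \<Rightarrow> bool list" where
  "embed n S = cube_point n (active n S) (\<lambda>i. \<exists>x\<in>S. x ! i)"

definition coords :: "nat \<Rightarrow> bool list set \<Rightarrow> nat set" where
  "coords n S = {k. k < 16 \<and> embed n S k \<in> S}"

lemma active_agree: "i < n \<Longrightarrow> i \<notin> active n S \<Longrightarrow> x \<in> S \<Longrightarrow> (\<exists>y\<in>S. y ! i) \<longleftrightarrow> x ! i"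
  unfolding active_def by blast

lemma embed_cong:
  assumes "S \<subseteq> T" "S \<noteq> {}" "active n S = active n T"
  shows "embed n S = embed n T"
proof -
  obtain x where "x \<in> S" using assms(2) by blast
  then have "(\<exists>y\<in>S. y ! i) \<longleftrightarrow> (\<exists>y\<in>T. y ! i)" if "i < n" "i \<notin> active n S" for i
    using active_agree[of i n S x] active_agree[of i n T x] that assms by auto
  then show ?thesis unfolding embed_def cube_point_def assms(3)[symmetric] by (intro ext map_cong) auto
qed

context four_cube
begin

lemma embed_point:
  assumes "M \<noteq> {}" "active n (point ` M) = W"
  shows "embed n (point ` M) = point"
proof -
  obtain k where k: "k \<in> M" using assms(1) by blast
  then have "(\<exists>y\<in>point ` M. y ! i) \<longleftrightarrow> f i" if "i < n" "i \<notin> W" for i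
    using active_agree[of i n "point ` M" "point k"] that assms(2) by (simp add: nth_point)
  then show ?thesis unfolding embed_def assms(2) cube_point_def by (intro ext map_cong) auto
qed

lemma coords_point:
  assumes "M \<noteq> {}" "M \<subseteq> {..<16}" "active n (point ` M) = W"
  shows "coords n (point ` M) = M"
  unfolding coords_def embed_point[OF assms(1,3)] using assms(2) inj_point by blast

lemma flip_point:
  assumes "M \<subseteq> {..<16}" "w < 16"
  shows "flip (point w) (point ` M) = point ` flip w M"
proof -
  have "point w \<in> point ` M \<longleftrightarrow> w \<in> M" using assms inj_point[OF assms(2)] by auto
  moreover have "point ` M - {point w} = point ` (M - {w})" using assms inj_point by blast
  ultimately show ?thesis unfolding flip_def by simp
qed

end

lemma residual_four_cube:
  assumes r: "residual n p S" and act: "card (active n S) = 4"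
  shows "four_cube n p (active n S) (\<lambda>i. \<exists>x\<in>S. x ! i)" "S = embed n S ` coords n S" "wide (coords n S)"
proof -
  have len: "length t = n" and pre: "\<not> t ! p" "\<And>i. i < p \<Longrightarrow> t ! i" if "t \<in> S" for t
    using r that unfolding residual_def VR_iff by auto
  have p: "p < n" and ne: "S \<noteq> {}" using r unfolding residual_def by auto
  show fc: "four_cube n p (active n S) (\<lambda>i. \<exists>x\<in>S. x ! i)"
  proof
    show "active n S \<subseteq> {p<..<n}"
    proof
      fix i assume i: "i \<in> active n S"
      then have "\<not> i < p" "i \<noteq> p" using pre unfolding active_def by auto
      then show "i \<in> {p<..<n}" using i unfolding active_def by auto
    qed
  qed (use act p pre ne in auto)
  interpret four_cube n p "active n S" "\<lambda>i. \<exists>x\<in>S. x ! i" by (rule fc)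
  have idx: "\<exists>k<16. x = embed n S k" if x: "x \<in> S" for x
  proof -
    obtain k :: nat where k: "k < 16" "\<forall>i\<in>active n S. bit k (rank (active n S) i) \<longleftrightarrow> x ! i"
      using exists_index by blast
    have "x ! i \<longleftrightarrow> point k ! i" if "i < n" for i
      using k(2) that active_agree[OF that _ x] by (simp add: nth_point)
    then have "x = point k" using len[OF x] by (simp add: list_eq_iff_nth_eq)
    then show ?thesis using k(1) unfolding embed_def by blast
  qed
  show S: "S = embed n S ` coords n S" unfolding coords_def using idx by blast
  have p_emb: "embed n S = point" by (simp add: embed_def)
  show "wide (coords n S)"
    unfolding wide_def
  proof (intro conjI ballI allI impI)
    show "coords n S \<subseteq> {..<16}" by (auto simp: coords_def)
    show "15 - k \<notin> coords n S" if "k \<in> coords n S" for k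
    proof
      assume "15 - k \<in> coords n S"
      then have "card (diffs (point k) (point (15 - k))) \<le> 3" "k < 16" "15 - k < 16"
        using that r unfolding coords_def p_emb residual_def VR_iff by auto
      then show False using bits(2)[of k "15 - k"] card_diffs_point by simp
    qed
    show "\<exists>x\<in>coords n S. x \<in> set (far u)" if u: "u < 16" for u
    proof -
      have "\<not> point u ! p" "\<forall>i<p. point u ! i" using W(1) p f by (auto simp: nth_point)
      moreover have "length (point u) = n" by simp
      ultimately obtain x where x: "x \<in> S" "3 \<le> card (diffs x (point u))"
        using r unfolding residual_def by blast
      obtain k where k: "k \<in> coords n S" "x = point k" using x(1) S unfolding p_emb by blast
      have "k < 16" using k(1) by (simp add: coords_def)
      moreover have "card (diffs (point k) (point u)) = card (diffs (point u) (point k))"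
        using diffs_commute[of "point k" "point u"] by simp
      ultimately have "k \<in> set (far u)" using bits(1)[OF u, of k] x(2) k(2) card_diffs_point by simp
      then show ?thesis using k(1) by blast
    qed
  qed
qed

section \<open>The matching and its key\<close>

definition toggle :: "nat \<Rightarrow> bool list set \<Rightarrow> bool list option" where
  "toggle n S = (if cand n S \<noteq> {} then Some (apex (cand n S))
     else if card (active n S) = 4 then map_option (embed n S) (pivot cube_tree (coords n S))
     else None)"

text \<open>Adding a vertex can only lower \<open>lead\<close>, shrink the candidates (at equal
  \<open>lead\<close>) and then enlarge \<open>low\<close> or the branch. The entries are arranged
  so that each such change raises the key lexicographically; 0 and 1 separate simplices with and
  without candidates.\<close>

definition key :: "nat \<Rightarrow> bool list set \<Rightarrow> nat list" where
  "key n S = (n - lead n S) # (if cand n S \<noteq> {} then [0, card (low n S)] else 1 # branch cube_tree (coords n S))"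

text \<open>The flip stays residual and spans the same 4-face, so labels are unchanged and the
  claims reduce to \<open>valid_pivot_Some\<close>.\<close>

lemma toggle_flip_residual:
  assumes r: "residual n p S" and t: "toggle n S = Some v"
  shows "flip v S \<in> VR n" "toggle n (flip v S) = Some v" "key n (flip v S) = key n S"
proof -
  note rd = residualD[OF r]
  have act: "card (active n S) = 4" using t rd by (auto simp: toggle_def split: if_splits)
  interpret four_cube n p "active n S" "\<lambda>i. \<exists>x\<in>S. x ! i" by (rule residual_four_cube(1)[OF r act])
  let ?M = "coords n S"
  have p_emb: "embed n S = point" by (simp add: embed_def)
  have S: "point ` ?M = S" and M: "wide ?M" using residual_four_cube[OF r act] by (simp_all add: p_emb)
  obtain w where w: "pivot cube_tree ?M = Some w" "v = point w"
    using t rd act by (auto simp: toggle_def p_emb)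
  have w': "w < 16" "wide (flip w ?M)" "pivot cube_tree (flip w ?M) = Some w"
    "branch cube_tree (flip w ?M) = branch cube_tree ?M"
    using valid_pivot_Some[OF valid_cube_tree M _ _ w(1)] by auto
  have M16: "?M \<subseteq> {..<16}" "flip w ?M \<subseteq> {..<16}" using M w'(2) unfolding wide_def by auto
  have fl: "flip v S = point ` flip w ?M" using flip_point[OF M16(1) w'(1)] S w(2) by simp
  have r': "residual n p (flip v S)" unfolding fl by (rule residual_point[OF w'(2)])
  have act': "active n (point ` flip w ?M) = active n S"
    using active_point_flip[OF M w'(2,1)] S by simp
  have "\<exists>x\<in>flip w ?M. x \<in> set (far 0)" using w'(2) unfolding wide_def by auto
  then have ne: "flip w ?M \<noteq> {}" by auto
  note c = coords_point[OF ne M16(2) act'] embed_point[OF ne act']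
  show "flip v S \<in> VR n" using r' unfolding residual_def by simp
  show "toggle n (flip v S) = Some v"
    using residualD[OF r'] act w(2) w'(3) unfolding toggle_def fl act' c by simp
  show "key n (flip v S) = key n S"
    using residualD[OF r'] rd w'(4) unfolding key_def fl c by simp
qed

lemma key_mono:
  assumes T: "insert w S \<in> VR n" "w \<notin> S"
    and t: "toggle n S = Some u" "toggle n (insert w S) = Some v"
  shows "key n S < key n (insert w S) \<or> key n S = key n (insert w S) \<and> u = v"
proof -
  let ?T = "insert w S"
  have S: "S \<in> VR n" using T(1) by (rule VR.down_closed) auto
  have "n \<le> lead n S \<or> (\<exists>x\<in>?T. \<not> x ! lead n S)"
    using lead_witness[of n S] by (cases "lead n S < n") auto
  then have le: "lead n ?T \<le> lead n S" unfolding lead_def[of n ?T] by (rule Least_le)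
  show ?thesis
  proof (cases "lead n ?T = lead n S")
    case False
    then have "n - lead n S < n - lead n ?T" using le lead_le[of n S] by linarith
    then show ?thesis by (simp add: key_def)
  next
    case lead: True
    have low: "low n S \<subseteq> low n ?T" by (auto simp: low_iff lead)
    then have cand: "cand n ?T \<subseteq> cand n S" by (auto simp: cand_def lead)
    show ?thesis
    proof (cases "cand n ?T = {}")
      case False
      then have ne: "cand n S \<noteq> {}" using cand by auto
      have fin: "finite (low n ?T)" using finite_VR[OF T(1)] by (simp add: low_def)
      show ?thesis
      proof (cases "low n S = low n ?T")
        case True
        then have "cand n S = cand n ?T" by (simp add: cand_def lead)
        then show ?thesis using t ne True lead by (simp add: toggle_def key_def)
      next
        case neq: False
        then have "card (low n S) < card (low n ?T)" using low fin by (intro psubset_card_mono) auto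
        then show ?thesis using ne False lead by (simp add: key_def)
      qed
    next
      case empT: True
      show ?thesis
      proof (cases "cand n S = {}")
        case False
        then show ?thesis using empT lead by (simp add: key_def)
      next
        case empS: True
        have "S \<noteq> {}" using residualI[OF S empS] by (simp add: residual_def)
        have act: "card (active n S) = 4" "card (active n ?T) = 4"
          using t empS empT by (auto simp: toggle_def split: if_splits)
        have "active n S \<subseteq> active n ?T" by (rule active_mono) blast
        \<comment> \<open>Both simplices span 4 dimensions, so they share their face and labelling,
          and \<open>branch_mono\<close> compares them.\<close>
        then have "active n S = active n ?T" using act by (intro card_subset_eq) auto
        then have emb: "embed n S = embed n ?T" using \<open>S \<noteq> {}\<close> by (intro embed_cong) auto
        then have "coords n S \<subseteq> coords n ?T" by (auto simp: coords_def)
        from branch_mono[OF this, of cube_tree] show ?thesis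
          using t act empS empT lead emb by (auto simp: toggle_def key_def)
      qed
    qed
  qed
qed

interpretation VR: morse_matching "VR n" "toggle n" "key n" for n
proof
  fix S v assume S: "S \<in> VR n" and t: "toggle n S = Some v"
  have "flip v S \<in> VR n \<and> toggle n (flip v S) = Some v \<and> key n (flip v S) = key n S"
  proof (cases "cand n S = {}")
    case True
    then show ?thesis using toggle_flip_residual[OF residualI[OF S True] t] by simp
  next
    case False
    then have v: "v = apex (cand n S)" using t by (simp add: toggle_def)
    have fc: "flip v S \<in> VR n" "lead n (flip v S) = lead n S" "low n (flip v S) = low n S"
      "cand n (flip v S) = cand n S"
      using flip_cand[OF S, of v] apex[OF S False] unfolding v by blast+
    show ?thesis using False v fc by (simp add: toggle_def key_def)
  qed
  then show "flip v S \<in> VR n" "toggle n (flip v S) = Some v" "key n (flip v S) = key n S" by auto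
qed (rule key_mono)

section \<open>Critical simplices and the resulting homology\<close>

lemma critical_card:
  assumes S: "S \<in> VR n" and t: "toggle n S = None"
  shows "card S \<in> {5, 8}"
proof -
  have c: "cand n S = {}" using t by (rule contrapos_pp) (simp add: toggle_def)
  note r = residualI[OF S c]
  show ?thesis
  proof (cases "card (active n S) = 4")
    case False
    then show ?thesis using residual_active[OF r] by simp
  next
    case True
    then have "pivot cube_tree (coords n S) = None" using t c by (simp add: toggle_def)
    then have *: "card (coords n S) \<in> {5, 8}"
      using valid_pivot_None[OF valid_cube_tree residual_four_cube(3)[OF r True]] by simp
    interpret four_cube n "lead n S" "active n S" "\<lambda>i. \<exists>x\<in>S. x ! i" by (rule residual_four_cube(1)[OF r True])
    have "inj_on (embed n S) (coords n S)"
      unfolding embed_def by (rule inj_onI, rule inj_point) (auto simp: coords_def)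
    then have "card (embed n S ` coords n S) = card (coords n S)" by (rule card_image)
    then show ?thesis using * residual_four_cube(2)[OF r True] by simp
  qed
qed

lemma critical_exists:
  assumes n: "5 \<le> n" and M: "wide M" "pivot cube_tree M = None"
  shows "\<exists>S\<in>VR n. toggle n S = None \<and> card S = card M"
proof -
  \<comment> \<open>One coordinate for the lead and four free directions after it: this is where
    \<open>5 \<le> n\<close> enters.\<close>
  interpret four_cube n "n - 5" "{n - 4..<n}" "\<lambda>i. i < n - 5"
    by standard (use n in auto)
  have M16: "M \<subseteq> {..<16}" using M(1) by (simp add: wide_def)
  have "\<exists>x\<in>M. x \<in> set (far 0)" using M(1) unfolding wide_def by auto
  then have ne: "M \<noteq> {}" by auto
  have r: "residual n (n - 5) (point ` M)" by (rule residual_point[OF M(1)])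
  have "toggle n (point ` M) = None"
  \<comment> \<open>If the points span fewer than four directions, \<open>toggle\<close> is
    \<open>None\<close> by definition.\<close>
  proof (cases "card (active n (point ` M)) = 4")
    case True
    then have "active n (point ` M) = {n - 4..<n}" using active_point[of M] W(2) by (intro card_subset_eq) auto
    then have "coords n (point ` M) = M" by (rule coords_point[OF ne M16])
    then show ?thesis using residualD[OF r] M(2) by (simp add: toggle_def)
  qed (use residualD[OF r] in \<open>simp add: toggle_def\<close>)
  moreover have "card (point ` M) = card M"
    by (rule card_image, rule inj_onI, rule inj_point) (use M16 in auto)
  moreover have "point ` M \<in> VR n" using r by (simp add: residual_def)
  ultimately show ?thesis by blast
qed

lemma wide_code: "wide (set xs) \<longleftrightarrow> (\<forall>x\<in>set xs. x < 16) \<and> (\<forall>x\<in>set xs. 15 - x \<notin> set xs) \<and>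
    (\<forall>u\<in>set [0..<16]. \<exists>x\<in>set xs. x \<in> set (far u))"
  unfolding wide_def by auto

text \<open>The vertex 0 and the four vertices at distance 3 from it.\<close>

lemma critical_5: "wide (set [7, 11, 13, 14, 0]) \<and> pivot cube_tree (set [7, 11, 13, 14, 0]) = None"
  unfolding wide_code by code_simp

text \<open>The even numbers, that is, a full 3-cube.\<close>

lemma critical_8: "wide (set [6, 10, 12, 2, 4, 8, 14, 0]) \<and> pivot cube_tree (set [6, 10, 12, 2, 4, 8, 14, 0]) = None"
  unfolding wide_code by code_simp

theorem theorem1p2:
  fixes n :: nat and i :: int
  assumes "n \<ge> 5"
  shows "carrier (reduced_homology (vr_complex (hypercube n) hamming 3) i)
           \<noteq> {\<one>\<^bsub>reduced_homology (vr_complex (hypercube n) hamming 3) i\<^esub>}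
         \<longleftrightarrow> i \<in> {4, 7}"
proof -
  have crit: "toggle n S \<noteq> None" if "S \<in> VR n" "int (card S) \<notin> {5, 8}" for S
    using critical_card[OF that(1)] that(2) by auto
  have "card (set [7, 11, 13, 14, 0 :: nat]) = 5" "card (set [6, 10, 12, 2, 4, 8, 14, 0 :: nat]) = 8" by simp_all
  then obtain S T where S: "S \<in> VR n" "toggle n S = None" "card S = 5"
    and T: "T \<in> VR n" "toggle n T = None" "card T = 8"
    using critical_exists[OF assms] critical_5 critical_8 by metis
  \<comment> \<open>Degree is size minus one, and the sizes adjacent to 5 and to 8 are free of
    critical simplices.\<close>
  have "\<not> cycles (VR n) 4 \<subseteq> boundaries (VR n) 4"
    by (rule VR.nontrivial_homology[OF S(1) _ S(2)]) (use S(3) crit in auto)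
  moreover have "\<not> cycles (VR n) 7 \<subseteq> boundaries (VR n) 7"
    by (rule VR.nontrivial_homology[OF T(1) _ T(2)]) (use T(3) crit in auto)
  moreover have "cycles (VR n) i \<subseteq> boundaries (VR n) i" if "i \<notin> {4, 7}"
    by (rule VR.trivial_homology) (use that crit in auto)
  ultimately show ?thesis unfolding VR.nontrivial_homology_iff by blast
qed

end
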